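(* There exists a constant $k_0$ such that for all integers $a, b$ with $a > 6$ and $a \geq b > 0$ there exists a positive integer $k \leq k_0$ for which the system $$ \begin{cases} \sum_{i=1}^k x_{1i} = a \\ \sum_{j=1}^k x_{2j} = b \\ x_{1s} + x_{2s} = p_s \text{ for every } s \in \{1,\dots,k\}, \text{ where each } p_s \text{ is an odd prime} \end{cases} $$ has a solution $(x_{11}, \dots, x_{1k}, x_{21}, \dots, x_{2k})$ with all $x_{ij} \in \mathbb{Z}_+$.
   Context: $\mathbb{Z}_+ = \{ n \in \mathbb{Z} : n \geq 0 \}$ denotes the set of non-negative integers. The constant $k_0$ does not depend on $a$ and $b$; the primes $p_s$ are not prescribed in advance and need not be distinct. *)

theory Defs
  imports Complex_Main "HOL-Computational_Algebra.Primes"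
begin

end

theory Submission
  imports Defs "HOL-Analysis.Analysis" "HOL-Number_Theory.Cong"
    "HOL-Computational_Algebra.Squarefree"
begin

text \<open>The system is solvable with given \<open>p\<^sub>s\<close> as soon as \<open>a + b\<close> is the sum of the \<open>p\<^sub>s\<close>, since each \<open>p\<^sub>s\<close> can be
  split freely into two nonnegative parts (\<open>ex_split_sum_list\<close>). As \<open>a + b \<ge> 8\<close>, the statement follows from
  Schnirelmann's theorem in the form that every integer \<open>n \<ge> 8\<close> is a sum of a bounded number of odd primes
  (\<open>sum_of_bounded_number_of_odd_primes\<close>).

  For the latter, let \<open>r(n)\<close> be the number of representations of \<open>n\<close> as a sum of two odd primes. An upper
  bound sieve gives \<open>r(n) \<le> C s(6n)\<^sup>2 x / (ln x)\<^sup>2\<close> for \<open>n \<le> x\<close>, where \<open>s(N)\<close> is the sum of the reciprocals of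
  the divisors of \<open>N\<close> (\<open>card_odd_prime_reps_le\<close>). The sieve (\<open>sieve_inequality\<close>) is a second moment argument
  with functions that are orthogonal modulo products of primes and constant on the sifted set; it
  requires no Moebius inversion. Since the fourth moment of \<open>s\<close> is bounded on average
  (\<open>sum_abundancy_pow4_le\<close>), the sum of \<open>r(n)\<^sup>2\<close> over \<open>n \<le> x\<close> is \<open>O(x\<^sup>3 / (ln x)\<^sup>4)\<close>. Chebyshev's lower bound for
  the number of primes (\<open>card_primes_lower_bound\<close>) shows that the sum of \<open>r(n)\<close> is at least of order
  \<open>(x / ln x)\<^sup>2\<close>, so by the Cauchy-Schwarz inequality a positive proportion of the integers up to \<open>x\<close> are sums of
  two odd primes (\<open>sums_of_two_odd_primes_positive_density\<close>).

  Together with \<open>0\<close> and \<open>1\<close> these sums form a set of positive Schnirelmann density, hence a basis of some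
  finite order \<open>h\<close> (\<open>schnirelmann_basis\<close>). Representing \<open>n - 8\<close> in this basis leaves \<open>l \<le> h\<close> ones, and \<open>l + 8\<close> is
  a sum of threes and fives.\<close>

section \<open>Schnirelmann density and additive bases\<close>

text \<open>The \<open>h\<close>-fold sumset of \<open>A\<close>, written as the set of sums of lists of length exactly \<open>h\<close>. All sets to
  which it is applied contain \<open>0\<close>, so that "exactly" can be read as "at most".\<close>

definition sumset_power :: "nat set \<Rightarrow> nat \<Rightarrow> nat set" where
  "sumset_power A h = {sum_list xs | xs. length xs = h \<and> set xs \<subseteq> A}"

lemma sumset_power_1: "sumset_power A 1 = A"
proof -
  have "a \<in> sumset_power A 1" if "a \<in> A" for a
    unfolding sumset_power_def using that by (intro CollectI exI[of _ "[a]"]) auto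
  moreover have "a \<in> A" if "a \<in> sumset_power A 1" for a
    using that unfolding sumset_power_def by (auto simp: length_Suc_conv)
  ultimately show ?thesis by blast
qed

lemma sumset_power_add:
  assumes "a \<in> sumset_power A h" "b \<in> sumset_power A k"
  shows "a + b \<in> sumset_power A (h + k)"
proof -
  obtain xs ys where "a = sum_list xs" "length xs = h" "set xs \<subseteq> A"
    "b = sum_list ys" "length ys = k" "set ys \<subseteq> A"
    using assms unfolding sumset_power_def by auto
  thus ?thesis unfolding sumset_power_def by (intro CollectI exI[of _ "xs @ ys"]) auto
qed

lemma zero_in_sumset_power:
  assumes "0 \<in> A"
  shows "0 \<in> sumset_power A h"
  unfolding sumset_power_def using assms
  by (intro CollectI exI[of _ "replicate h 0"]) (auto simp: sum_list_replicate)

text \<open>Schnirelmann's inequality for the density of \<open>C \<supseteq> A + B\<close>. Let \<open>a\<close> be the largest element of \<open>A\<close>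
  up to \<open>n\<close>. If \<open>a < n\<close>, the elements \<open>a + b\<close> with \<open>0 < b \<le> n - a\<close> all lie in \<open>C\<close>, beyond those up to \<open>a\<close>,
  and induction applies at \<open>a\<close>; if \<open>a = n\<close>, both counts exceed those at \<open>n - 1\<close> by one.\<close>

lemma schnirelmann_inequality:
  fixes A B C :: "nat set" and \<beta> :: real
  assumes "0 \<in> A" "0 \<in> B"
    and C: "\<And>a b. a \<in> A \<Longrightarrow> b \<in> B \<Longrightarrow> a + b \<in> C"
    and \<beta>: "\<And>n. \<beta> * real n \<le> real (card (B \<inter> {1..n}))"
  shows "real (card (A \<inter> {1..n})) + \<beta> * (real n - real (card (A \<inter> {1..n})))
           \<le> real (card (C \<inter> {1..n}))"
proof (induction n rule: less_induct)
  case (less n)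
  define a where "a = Max (A \<inter> {0..n})"
  have ne: "A \<inter> {0..n} \<noteq> {}" using \<open>0 \<in> A\<close> by force
  have a: "a \<in> A" "a \<le> n" using Max_in[of "A \<inter> {0..n}"] ne unfolding a_def by auto
  have a_max: "x \<le> a" if "x \<in> A" "x \<le> n" for x
    unfolding a_def using that by (intro Max_ge) auto
  show ?case
  proof (cases "n = 0")
    case True thus ?thesis by simp
  next
    case False
    show ?thesis
    proof (cases "a = n")
      case True
      hence "n \<in> A" using a by simp
      hence "n \<in> C" using C[of n 0] \<open>0 \<in> B\<close> by simp
      have ins: "{1..n} = insert n {1..n-1}" using False by auto
      have "card (A \<inter> {1..n}) = Suc (card (A \<inter> {1..n-1}))"
        using \<open>n \<in> A\<close> False unfolding ins by (subst Int_insert_right_if1) (auto)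
      moreover have "card (C \<inter> {1..n}) = Suc (card (C \<inter> {1..n-1}))"
        using \<open>n \<in> C\<close> False unfolding ins by (subst Int_insert_right_if1) (auto)
      moreover have "real (n - 1) = real n - 1" using False by simp
      ultimately show ?thesis using less[of "n-1"] False by (simp add: algebra_simps)
    next
      case an: False
      have eqA: "A \<inter> {1..n} = A \<inter> {1..a}" using a_max a by force
      have "(C \<inter> {1..a}) \<union> ((+) a) ` (B \<inter> {1..n-a}) \<subseteq> C \<inter> {1..n}"
        using C a by fastforce
      hence "card ((C \<inter> {1..a}) \<union> ((+) a) ` (B \<inter> {1..n-a})) \<le> card (C \<inter> {1..n})"
        by (intro card_mono) auto
      also have "card ((C \<inter> {1..a}) \<union> ((+) a) ` (B \<inter> {1..n-a}))
         = card (C \<inter> {1..a}) + card (((+) a) ` (B \<inter> {1..n-a}))"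
        by (intro card_Un_disjoint) auto
      also have "card (((+) a) ` (B \<inter> {1..n-a})) = card (B \<inter> {1..n-a})"
        by (intro card_image) auto
      finally have "real (card (C \<inter> {1..a})) + real (card (B \<inter> {1..n-a})) \<le> real (card (C \<inter> {1..n}))"
        by linarith
      moreover have "\<beta> * (real n - real a) \<le> real (card (B \<inter> {1..n-a}))"
        using \<beta>[of "n-a"] a by (simp add: of_nat_diff)
      moreover have "a < n" using a an by simp
      ultimately show ?thesis using less[of a] unfolding eqA by (simp add: algebra_simps)
    qed
  qed
qed

text \<open>Pigeonhole: unless \<open>n\<close> belongs to \<open>B\<close>, a set \<open>B\<close> with at least half of the integers in \<open>[1, n]\<close> meets
  its reflection \<open>n - B\<close>.\<close>

lemma mem_sumset_of_counts:
  fixes B :: "nat set"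
  assumes "0 \<in> B" and cnt: "n \<le> 2 * card (B \<inter> {1..n})"
  obtains a b where "a \<in> B" "b \<in> B" "n = a + b"
proof (cases "n \<in> B")
  case True
  thus ?thesis using assms that[of n 0] by simp
next
  case False
  show ?thesis
  proof (cases "n = 0")
    case True thus ?thesis using assms that[of 0 0] by simp
  next
    case n0: False
    let ?X = "B \<inter> {1..n}" and ?Y = "(\<lambda>b. n - b) ` (B \<inter> {1..n})"
    have nX: "?X \<subseteq> {1..<n}" using False by (auto simp: order_less_le)
    have Y: "?Y \<subseteq> {1..<n}" using nX by force
    have cY: "card ?Y = card ?X" by (intro card_image inj_onI) auto
    have "?X \<inter> ?Y \<noteq> {}"
    proof
      assume d: "?X \<inter> ?Y = {}"
      have "card (?X \<union> ?Y) = card ?X + card ?Y" by (intro card_Un_disjoint d) auto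
      moreover have "card (?X \<union> ?Y) \<le> card {1..<n}" using nX Y by (intro card_mono) auto
      ultimately show False using cY cnt n0 by simp
    qed
    then obtain a b where "a \<in> ?X" "b \<in> ?X" "a = n - b" by blast
    hence "a \<in> B" "b \<in> B" "n = a + b" by simp_all
    thus ?thesis by (rule that)
  qed
qed

text \<open>By the inequality above, the complement densities \<open>1 - d\<close> are submultiplicative, so iterated
  sumsets reach density above \<open>1/2\<close>; one more doubling covers everything.\<close>

theorem schnirelmann_basis:
  fixes A :: "nat set" and \<alpha> :: real
  assumes "0 \<in> A" and "\<alpha> > 0" and \<alpha>: "\<And>n. \<alpha> * real n \<le> real (card (A \<inter> {1..n}))"
  obtains h where "\<And>n. n \<in> sumset_power A h"
proof -
  have "\<alpha> \<le> 1"
  proof -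
    have "card (A \<inter> {1..1}) \<le> card {1..1::nat}" by (intro card_mono) auto
    thus ?thesis using \<alpha>[of 1] by simp
  qed
  have dens: "(1 - (1 - \<alpha>) ^ Suc k) * real n \<le> real (card (sumset_power A (Suc k) \<inter> {1..n}))" for k n
  proof (induction k arbitrary: n)
    case 0
    thus ?case using \<alpha>[of n] sumset_power_1[of A] by simp
  next
    case (Suc k)
    let ?c = "real (card (A \<inter> {1..n}))" and ?\<beta> = "1 - (1 - \<alpha>) ^ Suc k"
    have "?c + ?\<beta> * (real n - ?c) \<le> real (card (sumset_power A (Suc (Suc k)) \<inter> {1..n}))"
    proof (rule schnirelmann_inequality[where B = "sumset_power A (Suc k)"])
      fix a b assume "a \<in> A" "b \<in> sumset_power A (Suc k)"
      thus "a + b \<in> sumset_power A (Suc (Suc k))"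
        using sumset_power_add[of a A 1 b "Suc k"] sumset_power_1[of A] by simp
    qed (use assms Suc zero_in_sumset_power in auto)
    moreover have "(1 - \<alpha>) ^ Suc k * (\<alpha> * real n) \<le> (1 - \<alpha>) ^ Suc k * ?c"
      using \<alpha>[of n] \<open>\<alpha> \<le> 1\<close> by (intro mult_left_mono) auto
    ultimately show ?case by (simp add: algebra_simps)
  qed
  have "(\<lambda>k. (1 - \<alpha>) ^ k) \<longlonglongrightarrow> 0"
    using \<open>\<alpha> > 0\<close> \<open>\<alpha> \<le> 1\<close> by (intro LIMSEQ_realpow_zero) auto
  hence "eventually (\<lambda>k. (1 - \<alpha>) ^ k < 1/2) sequentially"
    by (rule order_tendstoD) simp
  then obtain K where K: "\<And>k. k \<ge> K \<Longrightarrow> (1 - \<alpha>) ^ k < 1/2"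
    unfolding eventually_sequentially by blast
  let ?B = "sumset_power A (Suc K)"
  have "n \<in> sumset_power A (Suc K + Suc K)" for n
  proof -
    have "1/2 * real n \<le> (1 - (1 - \<alpha>) ^ Suc K) * real n"
      using K[of "Suc K"] by (intro mult_right_mono) auto
    also have "\<dots> \<le> real (card (?B \<inter> {1..n}))" by (rule dens)
    finally have "n \<le> 2 * card (?B \<inter> {1..n})" by linarith
    then obtain a b where "a \<in> ?B" "b \<in> ?B" "n = a + b"
      using mem_sumset_of_counts zero_in_sumset_power[OF \<open>0 \<in> A\<close>] by metis
    thus ?thesis using sumset_power_add by blast
  qed
  thus ?thesis using that by blast
qed

section \<open>An upper bound sieve by orthogonality\<close>

text \<open>The Chinese remainder theorem as independence of functions with coprime periods.\<close>

lemma sum_mult_coprime_periods: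
  fixes F G :: "nat \<Rightarrow> real"
  assumes cop: "coprime a b" and "a > 0" "b > 0"
    and F: "\<And>m. F (m mod a) = F m" and G: "\<And>m. G (m mod b) = G m"
  shows "(\<Sum>m<a * b. F m * G m) = (\<Sum>m<a. F m) * (\<Sum>m<b. G m)"
proof -
  let ?f = "\<lambda>m. (m mod a, m mod b)"
  have inj: "inj_on ?f {..<a * b}"
  proof (rule inj_onI)
    fix x y assume xy: "x \<in> {..<a * b}" "y \<in> {..<a * b}" "?f x = ?f y"
    hence "[x = y] (mod a)" "[x = y] (mod b)" by (auto simp: cong_def)
    hence "[x = y] (mod a * b)" by (intro coprime_cong_mult_nat cop)
    thus "x = y" using xy by (intro cong_less_modulus_unique_nat[of x y "a * b"]) auto
  qed
  have sub: "?f ` {..<a * b} \<subseteq> {..<a} \<times> {..<b}" using assms by auto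
  have "?f ` {..<a * b} = {..<a} \<times> {..<b}"
    by (rule card_subset_eq) (use sub card_image[OF inj] in \<open>auto simp: card_cartesian_product\<close>)
  hence bij: "bij_betw ?f {..<a * b} ({..<a} \<times> {..<b})" using inj by (simp add: bij_betw_def)
  have "(\<Sum>m<a. F m) * (\<Sum>m<b. G m) = (\<Sum>(i, j)\<in>{..<a} \<times> {..<b}. F i * G j)"
    by (simp add: sum_product sum.cartesian_product)
  also have "\<dots> = (\<Sum>m<a * b. F (m mod a) * G (m mod b))"
    using sum.reindex_bij_betw[OF bij, of "\<lambda>(i, j). F i * G j"] by simp
  finally show ?thesis by (simp add: F G)
qed

lemma sum_prod_prime_periods:
  fixes u :: "nat \<Rightarrow> nat \<Rightarrow> real"
  assumes "finite T" and "\<And>p. p \<in> T \<Longrightarrow> prime p"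
    and "\<And>p m. p \<in> T \<Longrightarrow> u p (m mod p) = u p m"
  shows "(\<Sum>m<\<Prod>T. \<Prod>p\<in>T. u p m) = (\<Prod>p\<in>T. \<Sum>m<p. u p m)"
  using assms
proof (induction T rule: finite_induct)
  case empty
  thus ?case by simp
next
  case (insert q T)
  have cop: "coprime q (\<Prod>T)"
    using insert by (intro prod_coprime_right) (metis insert_iff primes_coprime)
  have per: "(\<Prod>p\<in>T. u p (m mod \<Prod>T)) = (\<Prod>p\<in>T. u p m)" for m
  proof (rule prod.cong[OF refl])
    fix p assume p: "p \<in> T"
    hence "p dvd \<Prod>T" using insert by (intro dvd_prodI) auto
    hence "(m mod \<Prod>T) mod p = m mod p" by (rule mod_mod_cancel)
    thus "u p (m mod \<Prod>T) = u p m" using insert.prems(2)[of p] p by (metis insert_iff)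
  qed
  have pos: "\<Prod>T > 0" "q > 0" using insert by (auto intro!: prod_pos prime_gt_0_nat)
  have "(\<Sum>m<\<Prod>(insert q T). \<Prod>p\<in>insert q T. u p m)
      = (\<Sum>m<q * \<Prod>T. u q m * (\<Prod>p\<in>T. u p m))"
    using insert by simp
  also have "\<dots> = (\<Sum>m<q. u q m) * (\<Sum>m<\<Prod>T. \<Prod>p\<in>T. u p m)"
    by (rule sum_mult_coprime_periods) (use insert.prems per pos cop in auto)
  finally show ?case using insert by simp
qed

lemma periodic_sum_approx:
  fixes F :: "nat \<Rightarrow> real"
  assumes "q > 0" and per: "\<And>m. F (m mod q) = F m" and bnd: "\<And>m. \<bar>F m\<bar> \<le> 1"
  shows "\<bar>(\<Sum>m<n. F m) - real n / real q * (\<Sum>m<q. F m)\<bar> \<le> 2 * real q"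
proof -
  define P where "P = (\<Sum>m<q. F m)"
  define k where "k = n div q"
  have n: "n = k * q + n mod q" unfolding k_def by simp
  have block: "sum F {i * q..<i * q + q} = P" for i
  proof -
    have "sum F {i * q..<i * q + q} = sum F {0 + i * q..<q + i * q}" by (simp add: add.commute)
    also have "\<dots> = (\<Sum>m=0..<q. F (m + i * q))" by (rule sum.shift_bounds_nat_ivl)
    also have "\<dots> = P" unfolding P_def atLeast0LessThan
    proof (rule sum.cong[OF refl])
      fix m show "F (m + i * q) = F m" using per[of "m + i * q"] per[of m] by simp
    qed
    finally show ?thesis .
  qed
  have full: "sum F {..<k * q} = real k * P"
    using sum.nat_group[of F q k] block by simp
  have "sum F {..<n} = sum F {..<k * q} + sum F {k * q..<n}"
    using n by (metis atLeast0LessThan le_add1 sum.atLeastLessThan_concat zero_le)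
  moreover have "\<bar>sum F {k * q..<n}\<bar> \<le> real (n mod q)"
  proof -
    have "\<bar>sum F {k * q..<n}\<bar> \<le> (\<Sum>m\<in>{k * q..<n}. 1)"
      using bnd by (intro order_trans[OF sum_abs] sum_mono) auto
    also have "\<dots> = real (n mod q)" unfolding k_def by (simp add: minus_div_mult_eq_mod)
    finally show ?thesis .
  qed
  moreover have "\<bar>P\<bar> \<le> real q"
  proof -
    have "\<bar>P\<bar> \<le> (\<Sum>m<q. 1)" unfolding P_def
      using bnd by (intro order_trans[OF sum_abs] sum_mono) auto
    thus ?thesis by simp
  qed
  moreover have "real n / real q * P = real k * P + real (n mod q) / real q * P"
  proof -
    have "real n = real k * real q + real (n mod q)" using n by (metis of_nat_add of_nat_mult)
    thus ?thesis using \<open>q > 0\<close> by (simp add: field_simps)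
  qed
  moreover have "\<bar>real (n mod q) / real q * P\<bar> \<le> 1 * \<bar>P\<bar>"
    unfolding abs_mult using \<open>q > 0\<close> by (intro mult_right_mono) (auto simp: less_imp_le)
  moreover have "real (n mod q) \<le> real q" using \<open>q > 0\<close> by (simp add: less_imp_le)
  ultimately show ?thesis unfolding full P_def[symmetric] by linarith
qed

text \<open>The orthogonal functions of the sieve for the \<open>m\<close> with \<open>m\<close> and \<open>n - m\<close> both prime. Modulo a prime
  \<open>p\<close> that does not divide \<open>n\<close>, the two classes of \<open>0\<close> and \<open>n\<close> are forbidden. The weight takes the constant
  value \<open>2 / (p - 2)\<close> on the allowed classes and \<open>-1\<close> on the forbidden ones, which makes its mean over a
  period vanish. The mean of its square is again \<open>2 / (p - 2)\<close>.\<close>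

definition sieve_weight :: "nat \<Rightarrow> nat \<Rightarrow> nat \<Rightarrow> real" where
  "sieve_weight n p m = (if p dvd m \<or> m mod p = n mod p then -1 else 2 / (real p - 2))"

lemma sieve_weight_mod: "sieve_weight n p (m mod p) = sieve_weight n p m"
  by (simp add: sieve_weight_def dvd_eq_mod_eq_0)

lemma sum_if_two_residues:
  fixes c d :: real
  assumes "p > 0" "\<not> p dvd n"
  shows "(\<Sum>m<p. if p dvd m \<or> m mod p = n mod p then c else d) = 2 * c + (real p - 2) * d"
proof -
  let ?B = "{0, n mod p}"
  have B: "?B \<subseteq> {..<p}" "card ?B = 2"
    using assms by (auto simp: dvd_eq_mod_eq_0 card_insert_if)
  hence "p \<ge> 2" using card_mono[OF _ B(1)] by simp
  have "(\<Sum>m<p. if p dvd m \<or> m mod p = n mod p then c else d)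
      = (\<Sum>m<p. if m \<in> ?B then c else d)"
    using assms by (intro sum.cong) (auto dest: nat_dvd_not_less)
  also have "\<dots> = (\<Sum>m\<in>{..<p} - ?B. d) + (\<Sum>m\<in>?B. c)"
    by (subst sum.subset_diff[OF B(1)]) (auto intro!: arg_cong2[where f = "(+)"] sum.cong)
  also have "\<dots> = real (p - 2) * d + 2 * c"
    using B by (simp add: card_Diff_subset)
  finally show ?thesis using \<open>p \<ge> 2\<close> by (simp add: of_nat_diff)
qed

lemma sum_sieve_weight:
  assumes "p \<ge> 5" "\<not> p dvd n"
  shows "(\<Sum>m<p. sieve_weight n p m) = 0"
    and "(\<Sum>m<p. (sieve_weight n p m)\<^sup>2) = real p * (2 / (real p - 2))"
proof -
  have "(\<Sum>m<p. sieve_weight n p m) = 2 * (-1) + (real p - 2) * (2 / (real p - 2))"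
    unfolding sieve_weight_def using assms by (intro sum_if_two_residues) auto
  also have "\<dots> = 0" using assms by (simp add: field_simps)
  finally show "(\<Sum>m<p. sieve_weight n p m) = 0" .
  have "(\<Sum>m<p. (sieve_weight n p m)\<^sup>2)
     = (\<Sum>m<p. if p dvd m \<or> m mod p = n mod p then 1 else (2 / (real p - 2))\<^sup>2)"
    unfolding sieve_weight_def by (intro sum.cong) auto
  also have "\<dots> = 2 * 1 + (real p - 2) * (2 / (real p - 2))\<^sup>2"
    using assms by (intro sum_if_two_residues) auto
  also have "\<dots> = real p * (2 / (real p - 2))"
  proof -
    have "2 * 1 + k * (2 / k)\<^sup>2 = (k + 2) * (2 / k)" if "k > 0" for k :: real
      using that by (simp add: field_simps power2_eq_square)
    from this[of "real p - 2"] show ?thesis using assms by simp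
  qed
  finally show "(\<Sum>m<p. (sieve_weight n p m)\<^sup>2) = real p * (2 / (real p - 2))" .
qed

lemma abs_sieve_weight_le_1: "p \<ge> 5 \<Longrightarrow> \<bar>sieve_weight n p m\<bar> \<le> 1"
  by (simp add: sieve_weight_def field_simps)

text \<open>Products of weights over two distinct finite sets of primes are orthogonal over a full period,
  since a prime in the symmetric difference contributes a factor \<open>0\<close>. The error on an interval of arbitrary
  length is bounded by twice the period, because the weights are at most \<open>1\<close> in modulus.\<close>

lemma sieve_weight_correlation:
  assumes fin: "finite T" "finite U" 
    and T: "\<And>p. p \<in> T \<union> U \<Longrightarrow> prime p \<and> p \<ge> 5 \<and> \<not> p dvd n"
    and z: "\<Prod>T \<le> z" "\<Prod>U \<le> z"
  shows "\<bar>(\<Sum>m<x. (\<Prod>p\<in>T. sieve_weight n p m) * (\<Prod>p\<in>U. sieve_weight n p m))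
           - (if T = U then real x * (\<Prod>p\<in>T. 2 / (real p - 2)) else 0)\<bar> \<le> 2 * (real z)\<^sup>2"
proof -
  let ?w = "sieve_weight n"
  define u where "u p m = (if p \<in> T then ?w p m else 1) * (if p \<in> U then ?w p m else 1)" for p m
  define q where "q = \<Prod>(T \<union> U)"
  have prime: "prime p" if "p \<in> T \<union> U" for p using T that by blast
  have prod_u: "(\<Prod>p\<in>T. ?w p m) * (\<Prod>p\<in>U. ?w p m) = (\<Prod>p\<in>T \<union> U. u p m)" for m
  proof -
    have "(\<Prod>p\<in>T. ?w p m) = (\<Prod>p\<in>T \<union> U. if p \<in> T then ?w p m else 1)"
      using fin by (intro prod.mono_neutral_cong_left) auto
    moreover have "(\<Prod>p\<in>U. ?w p m) = (\<Prod>p\<in>T \<union> U. if p \<in> U then ?w p m else 1)"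
      using fin by (intro prod.mono_neutral_cong_left) auto
    ultimately show ?thesis by (simp add: u_def prod.distrib)
  qed
  have u_mod: "u p (m mod p) = u p m" for p m by (simp add: u_def sieve_weight_mod)
  have pos: "\<Prod>S > 0" if "S \<subseteq> T \<union> U" for S
    using that prime by (intro prod_pos) (blast intro: prime_gt_0_nat)
  have "q > 0" unfolding q_def by (rule pos) simp
  have "\<bar>(\<Sum>m<x. \<Prod>p\<in>T \<union> U. u p m) - real x / real q * (\<Sum>m<q. \<Prod>p\<in>T \<union> U. u p m)\<bar>
      \<le> 2 * real q"
  proof (rule periodic_sum_approx[OF \<open>q > 0\<close>])
    fix m
    show "(\<Prod>p\<in>T \<union> U. u p (m mod q)) = (\<Prod>p\<in>T \<union> U. u p m)"
    proof (rule prod.cong[OF refl])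
      fix p assume p: "p \<in> T \<union> U"
      hence "p dvd q" unfolding q_def using fin by (intro dvd_prodI) auto
      hence "(m mod q) mod p = m mod p" by (rule mod_mod_cancel)
      thus "u p (m mod q) = u p m" using u_mod by metis
    qed
    have "\<bar>u p m\<bar> \<le> 1" if "p \<in> T \<union> U" for p
      unfolding u_def abs_mult using abs_sieve_weight_le_1[of p n m] T[OF that]
      by (intro mult_le_one) auto
    thus "\<bar>\<Prod>p\<in>T \<union> U. u p m\<bar> \<le> 1" unfolding abs_prod by (intro prod_le_1) auto
  qed
  moreover have "real x / real q * (\<Sum>m<q. \<Prod>p\<in>T \<union> U. u p m)
      = (if T = U then real x * (\<Prod>p\<in>T. 2 / (real p - 2)) else 0)"
  proof -
    have eq: "(\<Sum>m<q. \<Prod>p\<in>T \<union> U. u p m) = (\<Prod>p\<in>T \<union> U. \<Sum>m<p. u p m)"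
      unfolding q_def using fin prime u_mod by (intro sum_prod_prime_periods) auto
    show ?thesis
    proof (cases "T = U")
      case True
      have "(\<Prod>p\<in>T \<union> U. \<Sum>m<p. u p m) = (\<Prod>p\<in>T. real p * (2 / (real p - 2)))"
      proof (rule prod.cong)
        fix p assume p: "p \<in> T"
        hence "(\<Sum>m<p. u p m) = (\<Sum>m<p. (?w p m)\<^sup>2)"
          using True by (simp add: u_def power2_eq_square)
        thus "(\<Sum>m<p. u p m) = real p * (2 / (real p - 2))"
          using sum_sieve_weight(2)[of p n] T[of p] p by simp
      qed (use True in simp)
      also have "\<dots> = real q * (\<Prod>p\<in>T. 2 / (real p - 2))"
        unfolding prod.distrib q_def using True by simp
      finally show ?thesis using True \<open>q > 0\<close> unfolding eq by simp
    next
      case False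
      then obtain r where r: "r \<in> T \<union> U" "r \<in> T \<longleftrightarrow> r \<notin> U" by blast
      hence "(\<Sum>m<r. u r m) = (\<Sum>m<r. ?w r m)" by (intro sum.cong) (auto simp: u_def)
      also have "\<dots> = 0" using sum_sieve_weight(1)[of r n] T[of r] r by simp
      finally have "(\<Prod>p\<in>T \<union> U. \<Sum>m<p. u p m) = 0" using r fin by (intro prod_zero) auto
      thus ?thesis using False unfolding eq by simp
    qed
  qed
  moreover have "real q \<le> (real z)\<^sup>2"
  proof -
    have "q * 1 \<le> \<Prod>(T \<union> U) * \<Prod>(T \<inter> U)" unfolding q_def
      using pos[of "T \<inter> U"] by (intro mult_left_mono) (simp_all add: Suc_le_eq inf.coboundedI1)
    also have "\<dots> = \<Prod>T * \<Prod>U" using fin by (rule prod.union_inter)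
    also have "\<dots> \<le> z * z" using z by (rule mult_mono) auto
    finally show ?thesis by (metis mult.right_neutral of_nat_le_iff of_nat_mult power2_eq_square)
  qed
  ultimately show ?thesis unfolding prod_u by linarith
qed

text \<open>An upper bound sieve of the strength of Selberg's. On the sifted set \<open>S\<close> every product of weights
  is constant, so the sum \<open>F\<close> of all these products equals \<open>G\<close> there; hence \<open>|S| G\<^sup>2\<close> is at most the
  sum of \<open>F\<^sup>2\<close> over the whole interval, which orthogonality evaluates to \<open>x G\<close> up to the error terms.\<close>

theorem sieve_inequality:
  fixes \<D> :: "nat set set"
  assumes fin: "finite \<D>" "\<And>T. T \<in> \<D> \<Longrightarrow> finite T"
    and \<D>: "\<And>T p. T \<in> \<D> \<Longrightarrow> p \<in> T \<Longrightarrow> prime p \<and> p \<ge> 5 \<and> \<not> p dvd n"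
    and z: "\<And>T. T \<in> \<D> \<Longrightarrow> \<Prod>T \<le> z"
    and S: "S \<subseteq> {..<x}"
      "\<And>m T p. m \<in> S \<Longrightarrow> T \<in> \<D> \<Longrightarrow> p \<in> T \<Longrightarrow> \<not> p dvd m \<and> m mod p \<noteq> n mod p"
  defines "G \<equiv> (\<Sum>T\<in>\<D>. \<Prod>p\<in>T. 2 / (real p - 2))"
  shows "real (card S) * G\<^sup>2 \<le> real x * G + 2 * (real (card \<D>))\<^sup>2 * (real z)\<^sup>2"
proof -
  define e where "e T m = (\<Prod>p\<in>T. sieve_weight n p m)" for T m
  have G: "(\<Sum>T\<in>\<D>. e T m) = G" if "m \<in> S" for m
    unfolding G_def e_def sieve_weight_def using S(2)[OF that]
    by (intro sum.cong refl prod.cong) auto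
  have "real (card S) * G\<^sup>2 = (\<Sum>m\<in>S. (\<Sum>T\<in>\<D>. e T m)\<^sup>2)" using G by simp
  also have "\<dots> \<le> (\<Sum>m<x. (\<Sum>T\<in>\<D>. e T m)\<^sup>2)" using S(1) by (intro sum_mono2) auto
  also have "\<dots> = (\<Sum>m<x. \<Sum>T\<in>\<D>. \<Sum>U\<in>\<D>. e T m * e U m)"
    by (simp add: power2_eq_square sum_product)
  also have "\<dots> = (\<Sum>T\<in>\<D>. \<Sum>U\<in>\<D>. \<Sum>m<x. e T m * e U m)"
    by (subst sum.swap) (intro sum.cong refl sum.swap)
  also have "\<dots> \<le> (\<Sum>T\<in>\<D>. \<Sum>U\<in>\<D>.
       (if T = U then real x * (\<Prod>p\<in>T. 2 / (real p - 2)) else 0) + 2 * (real z)\<^sup>2)"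
  proof (intro sum_mono)
    fix T U assume "T \<in> \<D>" "U \<in> \<D>"
    hence "\<bar>(\<Sum>m<x. e T m * e U m)
             - (if T = U then real x * (\<Prod>p\<in>T. 2 / (real p - 2)) else 0)\<bar> \<le> 2 * (real z)\<^sup>2"
      unfolding e_def using fin \<D> z by (intro sieve_weight_correlation) blast+
    thus "(\<Sum>m<x. e T m * e U m)
      \<le> (if T = U then real x * (\<Prod>p\<in>T. 2 / (real p - 2)) else 0) + 2 * (real z)\<^sup>2" by linarith
  qed
  also have "\<dots> = real x * G + 2 * (real (card \<D>))\<^sup>2 * (real z)\<^sup>2"
    using fin(1) by (simp add: sum.distrib G_def sum_distrib_left power2_eq_square algebra_simps)
  finally show ?thesis .
qed

section \<open>Sums over squarefree integers coprime to a modulus\<close>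

text \<open>The abundancy index \<open>\<sigma>(N) / N\<close>, as the sum of the reciprocals of the divisors of \<open>N\<close>. It is only
  used for \<open>N > 0\<close>; the divisors of \<open>0\<close> form an infinite set, whose sum is \<open>0\<close> by convention.\<close>

definition abundancy :: "nat \<Rightarrow> real" where
  "abundancy N = (\<Sum>u | u dvd N. 1 / real u)"

lemma abundancy_ge_1:
  assumes "N > 0"
  shows "abundancy N \<ge> 1"
proof -
  have "(\<Sum>u\<in>{1}. 1 / real u) \<le> abundancy N"
    unfolding abundancy_def using assms by (intro sum_mono2) auto
  thus ?thesis by simp
qed

lemma sum_inverse_squares_le_2: "(\<Sum>k=1..y. 1 / (real k)\<^sup>2) \<le> 2"
proof -
  have "(\<Sum>k=1..y. 1 / (real k)\<^sup>2) \<le> 2 - 1 / real y" if "y > 0"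
    using that
  proof (induction y rule: nat_induct_non_zero)
    case 1
    thus ?case by simp
  next
    case (Suc n)
    have "1 / (real n + 1)\<^sup>2 \<le> 1 / (real n * (real n + 1))"
      using Suc.hyps by (intro divide_left_mono) (auto simp: power2_eq_square)
    also have "\<dots> = 1 / real n - 1 / (real n + 1)" using Suc.hyps by (simp add: field_simps)
    finally show ?case using Suc.IH by (simp add: add.commute)
  qed
  thus ?thesis by (cases "y = 0") (auto intro: order_trans)
qed

lemma prod_prime_factors_squarefree:
  fixes u :: nat
  assumes "squarefree u"
  shows "\<Prod>(prime_factors u) = u"
proof -
  have "u \<noteq> 0" using assms by (intro notI) auto
  hence "u = (\<Prod>p\<in>prime_factors u. p ^ multiplicity p u)" by (intro prime_factorization_nat) simp
  also have "\<dots> = \<Prod>(prime_factors u)"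
    using assms \<open>u \<noteq> 0\<close> by (intro prod.cong) (auto simp: squarefree_factorial_semiring')
  finally show ?thesis by simp
qed

lemma card_divisors_squarefree_le:
  fixes d :: nat
  assumes "squarefree d"
  shows "card {u. u dvd d} \<le> 2 ^ card (prime_factors d)"
proof -
  have "d \<noteq> 0" using assms by (intro notI) auto
  have "inj_on prime_factors {u. u dvd d}"
  proof (rule inj_onI)
    fix u v assume "u \<in> {u. u dvd d}" "v \<in> {u. u dvd d}" "prime_factors u = prime_factors v"
    thus "u = v" using prod_prime_factors_squarefree squarefree_mono assms
      by (metis mem_Collect_eq)
  qed
  moreover have "prime_factors ` {u. u dvd d} \<subseteq> Pow (prime_factors d)"
    using \<open>d \<noteq> 0\<close> by (auto intro: dvd_prime_factors[THEN subsetD])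
  ultimately have "card {u. u dvd d} \<le> card (Pow (prime_factors d))"
    by (intro card_inj_on_le[of prime_factors]) auto
  thus ?thesis by (simp add: card_Pow)
qed

text \<open>The squarefree integers in \<open>[1, y]\<close> that are coprime to \<open>N\<close>.\<close>

definition sqfree_coprime :: "nat \<Rightarrow> nat \<Rightarrow> nat set" where
  "sqfree_coprime N y = {v\<in>{1..y}. squarefree v \<and> coprime v N}"

lemma finite_sqfree_coprime [simp]: "finite (sqfree_coprime N y)"
  by (simp add: sqfree_coprime_def)

text \<open>Each \<open>m \<le> y\<close> factors as \<open>m = u v s\<^sup>2\<close> with \<open>u\<close> a divisor of \<open>N\<close> and \<open>v\<close> squarefree and coprime to
  \<open>N\<close>, so the harmonic sum up to \<open>y\<close> is at most the product of the three sums over \<open>s\<close>, \<open>u\<close> and \<open>v\<close>.\<close>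

lemma ln_le_sum_sqfree_coprime:
  assumes "N > 0"
  shows "ln (real y + 1) \<le> 2 * abundancy N * (\<Sum>v\<in>sqfree_coprime N y. 1 / real v)"
proof -
  let ?V = "sqfree_coprime N y" and ?U = "{u. u dvd N}"
  let ?g = "\<lambda>m. gcd (squarefree_part m) N"
  let ?\<phi> = "\<lambda>m. (square_part m, ?g m, squarefree_part m div ?g m)"
  let ?f = "\<lambda>(s, u, v). 1 / (real s)\<^sup>2 * (1 / real u * (1 / real v))"
  have decomp: "m = ?g m * (squarefree_part m div ?g m) * (square_part m)\<^sup>2" for m
    using squarefree_decompose[of m] by simp
  have inj: "inj_on ?\<phi> {1..y}"
  proof (rule inj_onI)
    fix m m' assume "?\<phi> m = ?\<phi> m'"
    thus "m = m'" using decomp[of m] decomp[of m'] by (metis prod.inject)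
  qed
  have sub: "?\<phi> ` {1..y} \<subseteq> {1..y} \<times> ?U \<times> ?V"
  proof (rule image_subsetI)
    fix m assume m: "m \<in> {1..y}"
    define s t where "s = square_part m" and "t = squarefree_part m"
    define g v where "g = gcd t N" and "v = t div g"
    have t: "t = g * v" unfolding g_def v_def by simp
    have m_eq: "m = t * s\<^sup>2" unfolding s_def t_def by (rule squarefree_decompose)
    have "squarefree t" unfolding t_def by simp
    hence "squarefree v" using t squarefree_mono by (metis dvd_triv_right)
    have "v > 0" "s > 0" using m t m_eq by (auto intro!: gr0I)
    have dvd: "s dvd m" "v dvd m" unfolding m_eq t by (auto simp: power2_eq_square)
    have "coprime v N"
    proof (rule ccontr)
      assume "\<not> coprime v N"
      hence "gcd v N \<noteq> 1" by (simp add: coprime_iff_gcd_eq_1)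
      then obtain p where p: "prime p" "p dvd v" "p dvd N"
        using prime_factor_nat by (metis dvd_gcdD1 dvd_gcdD2)
      hence "p dvd t" unfolding t by (intro dvd_mult)
      hence "p dvd g" unfolding g_def using p by (intro gcd_greatest)
      hence "p\<^sup>2 dvd t" unfolding t power2_eq_square using p by (intro mult_dvd_mono)
      thus False using \<open>squarefree t\<close> p(1) squarefreeD not_prime_unit by blast
    qed
    moreover have "s \<le> y" "v \<le> y" using dvd m by (auto dest!: dvd_imp_le)
    ultimately show "?\<phi> m \<in> {1..y} \<times> ?U \<times> ?V"
      using \<open>v > 0\<close> \<open>s > 0\<close> \<open>squarefree v\<close>
      unfolding s_def[symmetric] t_def[symmetric] g_def[symmetric] v_def[symmetric]
      by (auto simp: sqfree_coprime_def g_def)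
  qed
  have "ln (real y + 1) \<le> harm y" by (rule ln_le_harm)
  also have "\<dots> = (\<Sum>m\<in>{1..y}. ?f (?\<phi> m))"
    unfolding harm_def
  proof (rule sum.cong[OF refl])
    fix m
    have "inverse (of_nat m) = 1 / (real s)\<^sup>2 * (1 / real u * (1 / real v))"
      if "m = u * v * s\<^sup>2" for s u v unfolding that by (simp add: field_simps)
    from this[OF decomp] show "inverse (of_nat m) = ?f (?\<phi> m)" by (simp only: prod.case)
  qed
  also have "\<dots> = sum ?f (?\<phi> ` {1..y})"
    using sum.reindex[OF inj, of ?f] by (simp add: o_def)
  also have "\<dots> \<le> sum ?f ({1..y} \<times> ?U \<times> ?V)"
    using sub assms by (intro sum_mono2) auto
  also have "\<dots> = (\<Sum>s=1..y. 1 / (real s)\<^sup>2) * (abundancy N * (\<Sum>v\<in>?V. 1 / real v))"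
    by (simp only: sum.cartesian_product[symmetric] sum_product[symmetric] abundancy_def
        sum_distrib_left[symmetric] sum_distrib_right[symmetric] prod.case)
  also have "\<dots> \<le> 2 * (abundancy N * (\<Sum>v\<in>?V. 1 / real v))"
    using abundancy_ge_1[OF assms] 
    by (intro mult_right_mono sum_inverse_squares_le_2 mult_nonneg_nonneg sum_nonneg) auto
  finally show ?thesis by simp
qed

text \<open>Expand the square as a sum over pairs \<open>(a, b)\<close> and split off \<open>c = gcd a b\<close>: the cofactors are
  coprime, their product \<open>d\<close> is squarefree, and each \<open>d\<close> arises from at most \<open>2\<^sup>\<omega>\<close> factorizations, where \<open>\<omega>\<close>
  is the number of its prime factors.\<close>

lemma sum_sqfree_coprime_square_le:
  "(\<Sum>v\<in>sqfree_coprime N y. 1 / real v)\<^sup>2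
     \<le> 2 * (\<Sum>d\<in>sqfree_coprime N (y\<^sup>2). 2 ^ card (prime_factors d) / real d)"
proof -
  let ?V = "sqfree_coprime N y" and ?D = "sqfree_coprime N (y\<^sup>2)"
  let ?\<phi> = "\<lambda>(a, b). (gcd a b, (a div gcd a b) * (b div gcd a b), a div gcd a b)"
  let ?f = "\<lambda>(c, d, u::nat). 1 / (real c)\<^sup>2 * (1 / real d)"
  have inj: "inj_on ?\<phi> (?V \<times> ?V)"
  proof (rule inj_onI, clarify)
    fix a b a' b'
    assume "a \<in> ?V" "b \<in> ?V"
      and g: "gcd a b = gcd a' b'"
      and d: "a div gcd a b * (b div gcd a b) = a' div gcd a' b' * (b' div gcd a' b')"
      and a: "a div gcd a b = a' div gcd a' b'"
    hence pos: "a > 0" "b > 0" by (auto simp: sqfree_coprime_def)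
    have "a div gcd a b \<noteq> 0" using pos by (simp add: dvd_div_eq_0_iff)
    hence b: "b div gcd a b = b' div gcd a' b'" using d a by simp
    have "a = gcd a b * (a div gcd a b)" "b = gcd a b * (b div gcd a b)"
      "a' = gcd a' b' * (a' div gcd a' b')" "b' = gcd a' b' * (b' div gcd a' b')" by simp_all
    thus "a = a' \<and> b = b'" using g a b by metis
  qed
  have props: "gcd a b \<in> {1..y} \<and> (a div gcd a b) * (b div gcd a b) \<in> ?D
      \<and> real a * real b = (real (gcd a b))\<^sup>2 * real ((a div gcd a b) * (b div gcd a b))"
    if ab: "a \<in> ?V" "b \<in> ?V" for a b
  proof -
    define c a' b' where "c = gcd a b" and "a' = a div c" and "b' = b div c"
    have eq: "a = c * a'" "b = c * b'" unfolding a'_def b'_def c_def by auto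
    have V: "a > 0" "b > 0" "a \<le> y" "b \<le> y" "squarefree a" "squarefree b" "coprime a N" "coprime b N"
      using ab by (auto simp: sqfree_coprime_def)
    have c: "c > 0" "c \<le> y" unfolding c_def using V by (auto intro: order_trans[OF gcd_le1_nat])
    have cop: "coprime a' b'" unfolding a'_def b'_def c_def using V by (intro div_gcd_coprime) auto
    have sq: "squarefree (a' * b')"
    proof (rule squarefree_mult_coprime[OF cop])
      show "squarefree a'" using V(5) by (rule squarefree_mono[rotated]) (simp add: eq)
      show "squarefree b'" using V(6) by (rule squarefree_mono[rotated]) (simp add: eq)
    qed
    have "a' \<le> y" "b' \<le> y" unfolding a'_def b'_def using V by (auto intro: order_trans[OF div_le_dividend])
    hence le: "a' * b' \<le> y\<^sup>2" unfolding power2_eq_square by (rule mult_mono) auto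
    have "a' * b' > 0" using V eq by (auto intro!: gr0I)
    moreover have "coprime (a' * b') N" using V unfolding eq by simp
    ultimately show ?thesis using sq le c
      unfolding c_def[symmetric] a'_def[symmetric] b'_def[symmetric]
      by (auto simp: sqfree_coprime_def eq power2_eq_square)
  qed
  have sub: "?\<phi> ` (?V \<times> ?V) \<subseteq> {1..y} \<times> (SIGMA d:?D. {u. u dvd d})"
    using props by fastforce
  have finD: "finite {u. u dvd d}" if "d \<in> ?D" for d
    using that by (auto simp: sqfree_coprime_def)
  have "(\<Sum>v\<in>?V. 1 / real v)\<^sup>2 = (\<Sum>(a, b)\<in>?V \<times> ?V. 1 / (real a * real b))"
    by (simp add: power2_eq_square sum_product sum.cartesian_product)
  also have "\<dots> = (\<Sum>x\<in>?V \<times> ?V. ?f (?\<phi> x))"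
    using props by (intro sum.cong refl) (auto simp: split_beta)
  also have "\<dots> = sum ?f (?\<phi> ` (?V \<times> ?V))"
    using sum.reindex[OF inj, of ?f] by (simp add: o_def)
  also have "\<dots> \<le> sum ?f ({1..y} \<times> (SIGMA d:?D. {u. u dvd d}))"
    using sub finD by (intro sum_mono2 finite_cartesian_product finite_SigmaI) auto
  also have "\<dots> = (\<Sum>c=1..y. 1 / (real c)\<^sup>2 * (\<Sum>d\<in>?D. \<Sum>u | u dvd d. 1 / real d))"
    using finD by (simp add: sum.cartesian_product[symmetric] sum.Sigma[symmetric] sum_distrib_left)
  also have "\<dots> = (\<Sum>c=1..y. 1 / (real c)\<^sup>2) * (\<Sum>d\<in>?D. real (card {u. u dvd d}) / real d)"
    by (simp add: sum_distrib_right)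
  also have "\<dots> \<le> 2 * (\<Sum>d\<in>?D. 2 ^ card (prime_factors d) / real d)"
  proof (intro mult_mono sum_inverse_squares_le_2 sum_mono divide_right_mono sum_nonneg)
    fix d assume "d \<in> ?D"
    hence "card {u. u dvd d} \<le> 2 ^ card (prime_factors d)"
      by (intro card_divisors_squarefree_le) (auto simp: sqfree_coprime_def)
    thus "real (card {u. u dvd d}) \<le> 2 ^ card (prime_factors d)"
      by (metis of_nat_le_iff of_nat_numeral of_nat_power)
  qed auto
  finally show ?thesis .
qed

section \<open>The fourth moment of the abundancy index\<close>

text \<open>The fourth moment of the abundancy index is bounded on average. With \<open>Z = \<zeta>(5/4)\<close>, two applications
  of the Cauchy-Schwarz inequality bound the fourth power of the abundancy of \<open>N\<close> by \<open>Z\<^sup>3\<close> times the sum of \<open>u\<close>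
  to the power \<open>-1/4\<close> over the divisors \<open>u\<close> of \<open>N\<close>, and this divisor sum is \<open>\<le> Z\<close> on average.\<close>

lemma sum_abundancy_pow4_le:
  obtains C where "C > 0" "\<And>x. (\<Sum>n=1..x. abundancy (6 * n) ^ 4) \<le> C * real x"
proof -
  define Z where "Z = (\<Sum>n. real n powr (-5/4))"
  have summ: "summable (\<lambda>n. real n powr (-5/4))" by (subst summable_real_powr_iff) simp
  have Z: "(\<Sum>u\<in>A. real u powr (-5/4)) \<le> Z" if "finite A" for A
    unfolding Z_def using that by (intro sum_le_suminf summ) auto
  have "Z > 0" using Z[of "{1}"] by simp
  define t where "t N = (\<Sum>u | u dvd N. real u powr (-1/4))" for N
  have s_le: "abundancy N ^ 4 \<le> Z ^ 3 * t N" if "N > 0" for N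
  proof -
    let ?U = "{u. u dvd N}"
    have fin: "finite ?U" using that by simp
    have pos: "real u > 0" if "u \<in> ?U" for u using that \<open>N > 0\<close> by (auto intro!: gr0I)
    define w where "w = (\<Sum>u\<in>?U. real u powr (-3/4))"
    have w0: "w \<ge> 0" unfolding w_def by (intro sum_nonneg) auto
    have "abundancy N = (\<Sum>u\<in>?U. real u powr (-5/8) * real u powr (-3/8))"
      unfolding abundancy_def
    proof (rule sum.cong[OF refl])
      fix u assume "u \<in> ?U"
      from pos[OF this] show "1 / real u = real u powr (-5/8) * real u powr (-3/8)"
        by (simp add: powr_add[symmetric] powr_minus_divide)
    qed
    hence "(abundancy N)\<^sup>2 \<le> (\<Sum>u\<in>?U. (real u powr (-5/8))\<^sup>2) * (\<Sum>u\<in>?U. (real u powr (-3/8))\<^sup>2)"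
      using Cauchy_Schwarz_ineq_sum by metis
    also have "\<dots> = (\<Sum>u\<in>?U. real u powr (-5/4)) * w"
      unfolding w_def by (simp add: power2_eq_square powr_add[symmetric])
    also have "\<dots> \<le> Z * w" using Z[OF fin] w0 by (rule mult_right_mono)
    finally have 1: "(abundancy N)\<^sup>2 \<le> Z * w" .
    have "w = (\<Sum>u\<in>?U. real u powr (-5/8) * real u powr (-1/8))"
      unfolding w_def by (simp add: powr_add[symmetric])
    hence "w\<^sup>2 \<le> (\<Sum>u\<in>?U. (real u powr (-5/8))\<^sup>2) * (\<Sum>u\<in>?U. (real u powr (-1/8))\<^sup>2)"
      using Cauchy_Schwarz_ineq_sum by metis
    also have "\<dots> = (\<Sum>u\<in>?U. real u powr (-5/4)) * t N"
      unfolding t_def by (simp add: power2_eq_square powr_add[symmetric])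
    also have "\<dots> \<le> Z * t N" using Z[OF fin] by (intro mult_right_mono) (auto simp: t_def intro: sum_nonneg)
    finally have 2: "w\<^sup>2 \<le> Z * t N" .
    have "abundancy N ^ 4 = ((abundancy N)\<^sup>2)\<^sup>2" by simp
    also have "\<dots> \<le> (Z * w)\<^sup>2" using 1 by (intro power_mono) auto
    also have "\<dots> = Z\<^sup>2 * w\<^sup>2" by (simp add: power_mult_distrib)
    also have "\<dots> \<le> Z\<^sup>2 * (Z * t N)" using 2 by (intro mult_left_mono) auto
    finally show ?thesis by (simp add: power3_eq_cube power2_eq_square mult.assoc)
  qed
  have sum_t: "(\<Sum>N=1..X. t N) \<le> Z * real X" for X
  proof -
    have cnt: "real (card {N\<in>{1..X}. u dvd N}) \<le> real X / real u" if "u > 0" for u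
    proof -
      have "card {N\<in>{1..X}. u dvd N} \<le> card {1..X div u}"
      proof (rule card_inj_on_le[of "\<lambda>N. N div u"])
        show "inj_on (\<lambda>N. N div u) {N\<in>{1..X}. u dvd N}" 
          by (rule inj_onI) (metis (mono_tags, lifting) dvd_div_mult_self mem_Collect_eq)
        show "(\<lambda>N. N div u) ` {N\<in>{1..X}. u dvd N} \<subseteq> {1..X div u}"
          using that by (auto simp: div_le_mono Suc_le_eq div_greater_zero_iff dvd_imp_le)
      qed auto
      hence "real (card {N\<in>{1..X}. u dvd N}) \<le> real (X div u)" by simp
      also have "\<dots> \<le> real X / real u" by (rule of_nat_div_le_of_nat)
      finally show ?thesis .
    qed
    have "(\<Sum>N=1..X. t N) = (\<Sum>N=1..X. \<Sum>u | u \<in> {1..X} \<and> u dvd N. real u powr (-1/4))"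
      unfolding t_def
    proof (rule sum.cong[OF refl], rule sum.cong[OF _ refl])
      fix N assume N: "N \<in> {1..X}"
      show "{u. u dvd N} = {u. u \<in> {1..X} \<and> u dvd N}"
        using N by (auto dest: dvd_imp_le intro!: Suc_leI gr0I)
    qed
    also have "\<dots> = (\<Sum>u=1..X. \<Sum>N | N \<in> {1..X} \<and> u dvd N. real u powr (-1/4))"
      by (intro sum.swap_restrict) auto
    also have "\<dots> = (\<Sum>u=1..X. real (card {N\<in>{1..X}. u dvd N}) * real u powr (-1/4))"
      by simp
    also have "\<dots> \<le> (\<Sum>u=1..X. real X / real u * real u powr (-1/4))"
      using cnt by (intro sum_mono mult_right_mono) auto
    also have "\<dots> = real X * (\<Sum>u=1..X. real u powr (-5/4))"
      unfolding sum_distrib_left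
    proof (rule sum.cong[OF refl])
      fix u assume "u \<in> {1..X}"
      hence "real u > 0" by simp
      hence "real u powr (-5/4) = real u powr (-1) * real u powr (-1/4)"
        using powr_add[of "real u" "-1" "-1/4"] by simp
      thus "real X / real u * real u powr (-1/4) = real X * real u powr (-5/4)"
        using \<open>real u > 0\<close> by (simp add: powr_minus_divide)
    qed
    also have "\<dots> \<le> real X * Z" using Z by (intro mult_left_mono) auto
    finally show ?thesis by (simp add: mult.commute)
  qed
  have "(\<Sum>n=1..x. abundancy (6 * n) ^ 4) \<le> 6 * Z ^ 4 * real x" for x
  proof -
    have "(\<Sum>n=1..x. abundancy (6 * n) ^ 4) \<le> (\<Sum>n=1..x. Z ^ 3 * t (6 * n))"
      by (intro sum_mono s_le) auto
    also have "\<dots> = Z ^ 3 * (\<Sum>n=1..x. t (6 * n))" by (simp add: sum_distrib_left)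
    also have "(\<Sum>n=1..x. t (6 * n)) = (\<Sum>N\<in>(*) 6 ` {1..x}. t N)"
      by (subst sum.reindex) (auto intro: inj_onI)
    also have "\<dots> \<le> (\<Sum>N=1..6 * x. t N)"
      by (intro sum_mono2) (auto simp: t_def intro: sum_nonneg)
    also have "\<dots> \<le> Z * real (6 * x)" by (rule sum_t)
    finally show ?thesis using \<open>Z > 0\<close> by (simp add: power_numeral_reduce mult.assoc mult.left_commute)
  qed
  thus ?thesis using \<open>Z > 0\<close> by (intro that[of "6 * Z ^ 4"]) auto
qed

section \<open>Chebyshev's lower bound for the number of primes\<close>

text \<open>Nair's divisibility, by induction on \<open>n - m\<close>: the reciprocals of \<open>m * (n choose m)\<close> are the
  entries of Leibniz's harmonic triangle.\<close>

lemma binomial_dvd_lcm: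
  assumes "1 \<le> m" "m \<le> n"
  shows "m * (n choose m) dvd Lcm {1..n}"
  using assms
proof (induction "n - m" arbitrary: m n)
  case 0
  hence "m = n" by simp
  thus ?case using 0 by (auto intro: dvd_Lcm)
next
  case (Suc k)
  obtain n' where n: "n = Suc n'" using Suc by (cases n) auto
  have "m \<le> n'" using Suc.hyps(2) n by simp
  define L where "L = Lcm {1..n}"
  have "L \<noteq> 0" by (simp add: L_def)
  have "Lcm {1..n'} dvd L" unfolding L_def n by (intro Lcm_subset) auto
  moreover have "m * (n' choose m) dvd Lcm {1..n'}"
    using Suc.hyps(1)[of n' m] Suc.hyps(2) Suc.prems \<open>m \<le> n'\<close> n by simp
  ultimately obtain a where a: "L = m * (n' choose m) * a" by (meson dvd_def dvd_trans)
  have "Suc m * (n choose Suc m) dvd L" unfolding L_def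
    using Suc.hyps(1)[of n "Suc m"] Suc.hyps(2) Suc.prems \<open>m \<le> n'\<close> n by simp
  then obtain b where b: "L = Suc m * (n choose Suc m) * b" by (meson dvd_def)
  let ?X = "m * (n choose m)"
  have absorb: "(n - m) * (n choose m) = n * (n' choose m)"
    using binomial_absorb_comp[of n m] n by simp
  have "Suc m * (n choose Suc m) = n * (n' choose m)"
    using Suc_times_binomial_eq[of n' m] n by (simp add: mult.commute)
  hence La: "n * L = (n - m) * ?X * a" and Lb: "m * L = (n - m) * ?X * b"
    using absorb a b by (simp_all add: algebra_simps)
  \<comment> \<open>The recurrence of Leibniz's harmonic triangle, with denominators cleared.\<close>
  have "int (n - m) * int L = int (n * L) - int (m * L)"
    using Suc.prems by (simp add: of_nat_diff algebra_simps)
  also have "\<dots> = int (n - m) * (int ?X * (int a - int b))"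
    unfolding La Lb by (simp only: of_nat_mult right_diff_distrib mult.assoc)
  finally have "int L = int ?X * (int a - int b)" using \<open>m \<le> n'\<close> n by simp
  hence "int (m * (n choose m)) dvd int L" by simp
  thus ?case unfolding L_def by (simp only: int_dvd_int_iff)
qed

lemma prime_power_dvd_Lcm_upto:
  fixes n p :: nat
  assumes "prime p" "n > 0"
  shows "\<exists>k\<in>{1..n}. p ^ multiplicity p (Lcm {1..n}) dvd k"
  using assms(2)
proof (induction n rule: nat_induct_non_zero)
  case 1
  thus ?case by simp
next
  case (Suc n)
  let ?L = "Lcm {1..n}"
  have L: "Lcm {1..Suc n} = lcm (Suc n) ?L"
    using atLeastAtMostSuc_conv[of 1 n] by simp
  have "?L \<noteq> 0" by simp
  hence "multiplicity p (lcm (Suc n) ?L) = max (multiplicity p (Suc n)) (multiplicity p ?L)"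
    using assms(1) by (intro multiplicity_lcm) auto
  moreover have "p ^ multiplicity p (Suc n) dvd Suc n" by (rule multiplicity_dvd)
  ultimately show ?case using Suc.IH unfolding L max_def by fastforce
qed

lemma Lcm_upto_le_power_card_primes:
  fixes n :: nat
  assumes "n > 0"
  shows "Lcm {1..n} \<le> n ^ card {p. prime p \<and> p \<le> n}"
proof -
  let ?L = "Lcm {1..n}" and ?P = "{p. prime p \<and> p \<le> n}"
  have "?L \<noteq> 0" by simp
  have fin: "finite ?P" by (rule finite_subset[of _ "{..n}"]) auto
  have pow: "p ^ multiplicity p ?L \<le> n \<and> p \<le> n" if p: "p \<in> prime_factors ?L" for p
  proof -
    have "prime p" using p by auto
    then obtain k where k: "k \<in> {1..n}" "p ^ multiplicity p ?L dvd k"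
      using prime_power_dvd_Lcm_upto[of p n] assms by blast
    hence le: "p ^ multiplicity p ?L \<le> n" by (auto dest!: dvd_imp_le)
    moreover have "multiplicity p ?L > 0"
      using p by (simp add: prime_factors_multiplicity)
    hence "p ^ 1 \<le> p ^ multiplicity p ?L"
      using prime_ge_1_nat[OF \<open>prime p\<close>] by (intro power_increasing) auto
    ultimately show ?thesis by simp
  qed
  have "?L = (\<Prod>p\<in>prime_factors ?L. p ^ multiplicity p ?L)"
    using \<open>?L \<noteq> 0\<close> by (intro prime_factorization_nat) (simp only: neq0_conv)
  also have "\<dots> \<le> (\<Prod>p\<in>prime_factors ?L. n)" using pow by (intro prod_mono conjI) blast+
  also have "\<dots> = n ^ card (prime_factors ?L)" by simp
  also have "\<dots> \<le> n ^ card ?P"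
  proof (intro power_increasing card_mono fin subsetI)
    fix p assume "p \<in> prime_factors ?L"
    thus "p \<in> ?P" using pow[of p] in_prime_factors_imp_prime[of p ?L] by blast
  qed (use assms in simp)
  finally show ?thesis .
qed

text \<open>With \<open>m = n div 2\<close>, the least common multiple of \<open>1, \<dots>, n\<close> is at least \<open>m * (2 * m choose m) \<ge> 2 ^ m\<close> and
  at most \<open>n\<close> to the power of the number of primes up to \<open>n\<close>.\<close>

lemma card_primes_lower_bound:
  fixes n :: nat
  assumes "n \<ge> 2"
  shows "real n * ln 2 / 4 \<le> real (card {p. prime p \<and> p \<le> n}) * ln (real n)"
proof -
  define m where "m = n div 2"
  let ?c = "card {p. prime p \<and> p \<le> n}"
  have m: "m \<ge> 1" "2 * m \<le> n" "n \<le> 2 * m + 1" unfolding m_def using assms by auto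
  have "Lcm {1..n} \<noteq> 0" by simp
  have "m * (2 * m choose m) dvd Lcm {1..2 * m}" using m by (intro binomial_dvd_lcm) auto
  also have "\<dots> dvd Lcm {1..n}" using m by (intro Lcm_subset) auto
  finally have le: "m * (2 * m choose m) \<le> Lcm {1..n}"
    by (rule dvd_imp_le) (use \<open>Lcm {1..n} \<noteq> 0\<close> in blast)
  have "(2::real) ^ m * 2 \<le> 4 ^ m"
  proof -
    have "(2::real) ^ m * 2 \<le> 2 ^ m * 2 ^ m" using m by (intro mult_left_mono) (auto simp: self_le_power)
    thus ?thesis by (simp add: power_mult_distrib[symmetric])
  qed
  hence "(2::real) ^ m \<le> real m * (4 ^ m / (2 * real m))" using m by simp
  also have "\<dots> \<le> real m * real (2 * m choose m)"
    using m by (intro mult_left_mono central_binomial_lower_bound) auto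
  also have "\<dots> \<le> real (Lcm {1..n})" using le by (metis of_nat_le_iff of_nat_mult)
  also have "\<dots> \<le> real n ^ ?c"
    using Lcm_upto_le_power_card_primes[of n] assms by (metis le_trans of_nat_le_iff of_nat_power pos2 order_less_le_trans)
  finally have "ln ((2::real) ^ m) \<le> ln (real n ^ ?c)" using assms by (subst ln_le_cancel_iff) auto
  hence "real m * ln 2 \<le> real ?c * ln (real n)" using assms by (simp add: ln_realpow)
  moreover have "real n * ln 2 / 4 \<le> real m * ln 2"
  proof -
    have "real n \<le> 4 * real m" using m by linarith
    hence "real n * ln 2 \<le> 4 * real m * ln 2" by (intro mult_right_mono) auto
    thus ?thesis by simp
  qed
  ultimately show ?thesis by linarith
qed

section \<open>Upper bound for the number of representations as a sum of two odd primes\<close>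

text \<open>The representations \<open>n = p + q\<close> by odd primes, each given by its first summand \<open>p\<close>. The truncated
  subtraction is harmless because of \<open>p \<le> n\<close>.\<close>

definition odd_prime_reps :: "nat \<Rightarrow> nat set" where
  "odd_prime_reps n = {p. prime p \<and> odd p \<and> p \<le> n \<and> prime (n - p) \<and> odd (n - p)}"

lemma finite_odd_prime_reps [simp]: "finite (odd_prime_reps n)"
  by (rule finite_subset[of _ "{..n}"]) (auto simp: odd_prime_reps_def)

text \<open>Coprimality to \<open>6\<close> removes the prime \<open>2\<close>, modulo which every class is forbidden for odd \<open>n\<close>, and the
  prime \<open>3\<close>, whose weight would take the value \<open>2\<close>.\<close>

lemma prime_factors_sqfree_coprime:
  assumes "d \<in> sqfree_coprime (6 * n) z" "p \<in> prime_factors d"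
  shows "prime p \<and> p \<ge> 5 \<and> \<not> p dvd n"
proof -
  have p: "prime p" "p dvd d" using assms(2) by auto
  have "coprime d (6 * n)" using assms(1) by (simp add: sqfree_coprime_def)
  hence nd: "\<not> p dvd 6 * n" using p coprime_common_divisor not_prime_unit by blast
  have "(2::nat) dvd 6 * n" "(3::nat) dvd 6 * n" by (auto intro: dvd_mult2)
  hence "p \<noteq> 2" "p \<noteq> 3" using nd by auto
  moreover have "p \<noteq> 4" using p(1) prime_product[of 2 2] by (intro notI) simp
  ultimately show ?thesis using p nd prime_ge_2_nat[OF p(1)] by auto
qed

lemma inj_on_prime_factors_sqfree_coprime: "inj_on prime_factors (sqfree_coprime N z)"
  by (rule inj_onI) (metis (no_types, lifting) mem_Collect_eq prod_prime_factors_squarefree sqfree_coprime_def)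

text \<open>The lower bound for the sieve sum \<open>G\<close>, taken over the prime factor sets of the squarefree \<open>d \<le> y\<^sup>2\<close>
  coprime to \<open>6 n\<close>.\<close>

lemma ln_square_le_sieve_sum:
  assumes "n > 0"
  shows "(ln (real y + 1))\<^sup>2 \<le> 8 * (abundancy (6 * n))\<^sup>2 *
     (\<Sum>T\<in>prime_factors ` sqfree_coprime (6 * n) (y\<^sup>2). \<Prod>p\<in>T. 2 / (real p - 2))"
proof -
  let ?D = "sqfree_coprime (6 * n) (y\<^sup>2)" and ?s = "abundancy (6 * n)"
  let ?H = "\<Sum>v\<in>sqfree_coprime (6 * n) y. 1 / real v"
  have "(ln (real y + 1))\<^sup>2 \<le> (2 * ?s * ?H)\<^sup>2"
    using assms by (intro power_mono ln_le_sum_sqfree_coprime) auto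
  also have "\<dots> = 4 * ?s\<^sup>2 * ?H\<^sup>2" by (simp add: power_mult_distrib)
  also have "\<dots> \<le> 4 * ?s\<^sup>2 * (2 * (\<Sum>d\<in>?D. 2 ^ card (prime_factors d) / real d))"
    by (intro mult_left_mono sum_sqfree_coprime_square_le) auto
  also have "\<dots> = 8 * ?s\<^sup>2 * (\<Sum>d\<in>?D. 2 ^ card (prime_factors d) / real d)" by simp
  also have "\<dots> \<le> 8 * ?s\<^sup>2 * (\<Sum>d\<in>?D. \<Prod>p\<in>prime_factors d. 2 / (real p - 2))"
  proof (intro mult_left_mono sum_mono)
    fix d assume d: "d \<in> ?D"
    have "real d = (\<Prod>p\<in>prime_factors d. real p)"
      using prod_prime_factors_squarefree[of d] d by (simp add: sqfree_coprime_def flip: of_nat_prod)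
    hence "2 ^ card (prime_factors d) / real d = (\<Prod>p\<in>prime_factors d. 2 / real p)"
      by (simp add: prod_dividef)
    also have "\<dots> \<le> (\<Prod>p\<in>prime_factors d. 2 / (real p - 2))"
    proof (rule prod_mono)
      fix p assume "p \<in> prime_factors d"
      hence "p \<ge> 5" using prime_factors_sqfree_coprime[OF d] by blast
      thus "0 \<le> 2 / real p \<and> 2 / real p \<le> 2 / (real p - 2)"
        by (auto intro!: divide_left_mono)
    qed
    finally show "2 ^ card (prime_factors d) / real d \<le> (\<Prod>p\<in>prime_factors d. 2 / (real p - 2))" .
  qed auto
  also have "(\<Sum>d\<in>?D. \<Prod>p\<in>prime_factors d. 2 / (real p - 2))
      = (\<Sum>T\<in>prime_factors ` ?D. \<Prod>p\<in>T. 2 / (real p - 2))"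
    by (simp add: sum.reindex[OF inj_on_prime_factors_sqfree_coprime])
  finally show ?thesis .
qed

text \<open>The sieve bound for the number of representations, with level \<open>z = y\<^sup>2\<close>: representations in which
  both primes exceed \<open>z\<close> lie in the sifted set, and at most \<open>2 (z + 1)\<close> others exist.\<close>

lemma card_odd_prime_reps_le_sieve:
  assumes n: "0 < n" "n \<le> x" and "y > 0"
  shows "real (card (odd_prime_reps n)) * (ln (real y + 1))\<^sup>2
    \<le> 8 * (abundancy (6 * n))\<^sup>2 * real x + (2 * real y ^ 8 + 2 * (real y)\<^sup>2 + 2) * (ln (real y + 1))\<^sup>2"
proof -
  define z where "z = y\<^sup>2"
  define \<D> where "\<D> = prime_factors ` sqfree_coprime (6 * n) z"
  define G where "G = (\<Sum>T\<in>\<D>. \<Prod>p\<in>T. 2 / (real p - 2))"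
  define S where "S = {m\<in>{..<x}. \<forall>T\<in>\<D>. \<forall>p\<in>T. \<not> p dvd m \<and> m mod p \<noteq> n mod p}"
  let ?l = "ln (real y + 1)"
  have \<D>: "prime p \<and> p \<ge> 5 \<and> \<not> p dvd n \<and> p \<le> z" if "T \<in> \<D>" "p \<in> T" for T p
  proof -
    obtain d where d: "d \<in> sqfree_coprime (6 * n) z" "T = prime_factors d"
      using \<open>T \<in> \<D>\<close> by (auto simp: \<D>_def)
    hence "p dvd d" "d \<le> z" "d > 0" using \<open>p \<in> T\<close> by (auto simp: sqfree_coprime_def)
    hence "p \<le> z" by (meson dvd_imp_le le_trans)
    thus ?thesis using prime_factors_sqfree_coprime[of d n z p] d that by simp
  qed
  have fin: "finite \<D>" "\<And>T. T \<in> \<D> \<Longrightarrow> finite T" unfolding \<D>_def by auto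
  have prod_le: "\<Prod>T \<le> z" if "T \<in> \<D>" for T
    using that prod_prime_factors_squarefree by (auto simp: \<D>_def sqfree_coprime_def)
  have card\<D>: "card \<D> \<le> z"
  proof -
    have "card \<D> \<le> card (sqfree_coprime (6 * n) z)" unfolding \<D>_def by (rule card_image_le) simp
    also have "\<dots> \<le> card {1..z}" by (rule card_mono) (auto simp: sqfree_coprime_def)
    finally show ?thesis by simp
  qed
  have "G \<ge> 1"
  proof -
    have "z \<ge> 1" unfolding z_def using \<open>y > 0\<close> by simp
    hence "{} \<in> \<D>" unfolding \<D>_def by (intro image_eqI[of _ _ 1]) (auto simp: sqfree_coprime_def)
    moreover have "0 \<le> (\<Prod>p\<in>T. 2 / (real p - 2))" if "T \<in> \<D>" for T
      using \<D>[OF that] by (intro prod_nonneg) fastforce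
    ultimately have "(\<Sum>T\<in>{{}}. \<Prod>p\<in>T. 2 / (real p - 2)) \<le> G"
      unfolding G_def using fin by (intro sum_mono2) auto
    thus ?thesis by simp
  qed
  have "real (card S) * G\<^sup>2 \<le> real x * G + 2 * (real (card \<D>))\<^sup>2 * (real z)\<^sup>2"
    unfolding G_def using fin \<D> prod_le by (intro sieve_inequality) (auto simp: S_def)
  also have "\<dots> \<le> real x * G + 2 * (real z)\<^sup>2 * (real z)\<^sup>2"
    using card\<D> by (intro add_left_mono mult_right_mono mult_left_mono power_mono) auto
  also have "\<dots> = real x * G + 2 * real y ^ 8"
    unfolding z_def by (simp add: power_mult[symmetric] flip: power_add)
  also have "\<dots> \<le> real x * G + 2 * real y ^ 8 * G\<^sup>2"
    using mult_left_mono[OF one_le_power[OF \<open>G \<ge> 1\<close>, of 2], of "2 * real y ^ 8"] by simp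
  finally have "(real (card S) * G) * G \<le> (real x + 2 * real y ^ 8 * G) * G"
    by (simp add: power2_eq_square algebra_simps)
  hence SG: "real (card S) * G \<le> real x + 2 * real y ^ 8 * G" using \<open>G \<ge> 1\<close> by simp
  have lG: "?l\<^sup>2 \<le> 8 * (abundancy (6 * n))\<^sup>2 * G"
    using ln_square_le_sieve_sum[OF n(1), of y] unfolding G_def \<D>_def z_def .
  have S_bound: "real (card S) * ?l\<^sup>2 \<le> 8 * (abundancy (6 * n))\<^sup>2 * real x + 2 * real y ^ 8 * ?l\<^sup>2"
  proof (cases "real (card S) \<le> 2 * real y ^ 8")
    case True
    hence "real (card S) * ?l\<^sup>2 \<le> 2 * real y ^ 8 * ?l\<^sup>2" by (intro mult_right_mono) auto
    thus ?thesis by (simp add: add_increasing)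
  next
    case False
    hence "(real (card S) - 2 * real y ^ 8) * ?l\<^sup>2
      \<le> (real (card S) - 2 * real y ^ 8) * (8 * (abundancy (6 * n))\<^sup>2 * G)"
      by (intro mult_left_mono lG) auto
    also have "\<dots> = 8 * (abundancy (6 * n))\<^sup>2 * (real (card S) * G - 2 * real y ^ 8 * G)"
      by (simp add: algebra_simps)
    also have "\<dots> \<le> 8 * (abundancy (6 * n))\<^sup>2 * real x" using SG by (intro mult_left_mono) auto
    finally show ?thesis by (simp add: algebra_simps)
  qed
  have "odd_prime_reps n \<subseteq> S \<union> {..z} \<union> (\<lambda>q. n - q) ` {..z}"
  proof
    fix p assume p: "p \<in> odd_prime_reps n"
    hence pr: "prime p" "prime (n - p)" "p \<le> n" by (auto simp: odd_prime_reps_def)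
    have "p < n" using prime_gt_0_nat[OF pr(2)] by simp
    show "p \<in> S \<union> {..z} \<union> (\<lambda>q. n - q) ` {..z}"
    proof (cases "p \<le> z \<or> n - p \<le> z")
      case True
      moreover have "p = n - (n - p)" using pr by simp
      ultimately show ?thesis by blast
    next
      case False
      have "\<not> l dvd p \<and> p mod l \<noteq> n mod l" if "T \<in> \<D>" "l \<in> T" for T l
      proof -
        have l: "prime l" "l \<le> z" using \<D> that by auto
        have "\<not> l dvd p" "\<not> l dvd n - p"
          using primes_dvd_imp_eq[OF l(1) pr(1)] primes_dvd_imp_eq[OF l(1) pr(2)] l(2) False by auto
        moreover have "l dvd n - p" if "p mod l = n mod l"
          using that pr by (metis mod_eq_dvd_iff_nat)
        ultimately show ?thesis by blast
      qed
      hence "p \<in> S" unfolding S_def using \<open>p < n\<close> n by auto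
      thus ?thesis by blast
    qed
  qed
  hence "card (odd_prime_reps n) \<le> card (S \<union> {..z} \<union> (\<lambda>q. n - q) ` {..z})"
    by (rule card_mono[rotated]) (auto simp: S_def)
  also have "\<dots> \<le> card S + card {..z} + card ((\<lambda>q. n - q) ` {..z})"
    by (intro order_trans[OF card_Un_le] add_right_mono card_Un_le)
  also have "\<dots> \<le> card S + card {..z} + card {..z}"
    by (intro add_left_mono card_image_le) auto
  finally have "real (card (odd_prime_reps n)) \<le> real (card S) + (2 * (real y)\<^sup>2 + 2)"
    unfolding z_def by (simp flip: of_nat_power)
  hence "real (card (odd_prime_reps n)) * ?l\<^sup>2 \<le> (real (card S) + (2 * (real y)\<^sup>2 + 2)) * ?l\<^sup>2"
    by (intro mult_right_mono) auto
  with S_bound show ?thesis by (simp add: algebra_simps)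
qed

text \<open>Here \<open>y\<close> is the integer part of the 16th root of \<open>x\<close>, so that the error terms are \<open>O(\<surd>x)\<close> while
  \<open>ln (y + 1)\<close> is still of the order of \<open>ln x\<close>.\<close>

theorem card_odd_prime_reps_le:
  assumes "x \<ge> 2" "0 < n" "n \<le> x"
  shows "real (card (odd_prime_reps n)) \<le> 2144 * (abundancy (6 * n))\<^sup>2 * real x / (ln (real x))\<^sup>2"
proof -
  define r where "r = real x powr (1/16)"
  define y where "y = nat \<lfloor>r\<rfloor>"
  let ?s = "abundancy (6 * n)" and ?R = "real (card (odd_prime_reps n))"
  let ?l = "ln (real y + 1)" and ?L = "ln (real x)"
  have "r \<ge> 1" unfolding r_def using assms by (intro ge_one_powr_ge_zero) auto
  hence y: "y > 0" "real y \<le> r" "r \<le> real y + 1" unfolding y_def by linarith+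
  have "?L > 0" using assms by simp
  have r8: "r ^ 8 = sqrt (real x)"
    unfolding r_def using assms by (simp add: powr_powr powr_half_sqrt flip: powr_realpow)
  have "?L / 16 = ln r" unfolding r_def using assms by (simp add: ln_powr)
  also have "\<dots> \<le> ?l" using y \<open>r \<ge> 1\<close> by (subst ln_le_cancel_iff) auto
  finally have l: "?L / 16 \<le> ?l" .
  have l2: "?L\<^sup>2 \<le> 256 * ?l\<^sup>2"
    using power_mono[OF l, of 2] \<open>?L > 0\<close> by (simp add: power_divide)
  have err: "2 * real y ^ 8 + 2 * (real y)\<^sup>2 + 2 \<le> 6 * sqrt (real x)"
  proof -
    have "real y ^ 8 \<le> r ^ 8" using y by (intro power_mono) auto
    moreover have "(real y)\<^sup>2 \<le> r\<^sup>2" using y by (intro power_mono) auto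
    moreover have "r\<^sup>2 \<le> r ^ 8" using \<open>r \<ge> 1\<close> by (intro power_increasing) auto
    moreover have "1 \<le> r ^ 8" using \<open>r \<ge> 1\<close> by (rule one_le_power)
    ultimately show ?thesis using r8 by linarith
  qed
  have sqrt_le: "sqrt (real x) * ?L\<^sup>2 \<le> 16 * real x"
  proof -
    have "?L = 4 * ln (real x powr (1/4))" using assms by (simp add: ln_powr)
    also have "\<dots> \<le> 4 * real x powr (1/4)"
      using assms ln_le_minus_one[of "real x powr (1/4)"] by simp
    finally have "?L\<^sup>2 \<le> (4 * real x powr (1/4))\<^sup>2" using \<open>?L > 0\<close> by (intro power_mono) auto
    also have "\<dots> = 16 * sqrt (real x)"
      using assms by (simp add: power_mult_distrib power2_eq_square powr_half_sqrt flip: powr_add)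
    finally have "sqrt (real x) * ?L\<^sup>2 \<le> sqrt (real x) * (16 * sqrt (real x))"
      by (intro mult_left_mono) auto
    also have "\<dots> = 16 * real x" by simp
    finally show ?thesis .
  qed
  have "?R * ?l\<^sup>2 \<le> 8 * ?s\<^sup>2 * real x + 6 * sqrt (real x) * ?l\<^sup>2"
    using card_odd_prime_reps_le_sieve[OF assms(2,3) y(1)] mult_right_mono[OF err, of "?l\<^sup>2"] by simp
  hence "(?R - 6 * sqrt (real x)) * ?l\<^sup>2 \<le> 8 * ?s\<^sup>2 * real x" by (simp add: algebra_simps)
  have main: "(?R - 6 * sqrt (real x)) * ?L\<^sup>2 \<le> 2048 * ?s\<^sup>2 * real x"
  proof (cases "?R \<le> 6 * sqrt (real x)")
    case True
    hence "(?R - 6 * sqrt (real x)) * ?L\<^sup>2 \<le> 0" by (intro mult_nonpos_nonneg) auto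
    thus ?thesis by (rule order_trans) auto
  next
    case False
    hence "(?R - 6 * sqrt (real x)) * ?L\<^sup>2 \<le> (?R - 6 * sqrt (real x)) * (256 * ?l\<^sup>2)"
      using l2 by (intro mult_left_mono) auto
    also have "\<dots> = 256 * ((?R - 6 * sqrt (real x)) * ?l\<^sup>2)" by simp
    also have "\<dots> \<le> 256 * (8 * ?s\<^sup>2 * real x)"
      by (intro mult_left_mono \<open>(?R - 6 * sqrt (real x)) * ?l\<^sup>2 \<le> 8 * ?s\<^sup>2 * real x\<close>) auto
    finally show ?thesis by simp
  qed
  have "1 * real x \<le> ?s\<^sup>2 * real x"
    using abundancy_ge_1[of "6 * n"] assms by (intro mult_right_mono one_le_power) auto
  hence "?R * ?L\<^sup>2 \<le> 2144 * ?s\<^sup>2 * real x" using main sqrt_le by (simp add: algebra_simps)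
  thus ?thesis using \<open>?L > 0\<close> by (simp add: pos_le_divide_eq)
qed

section \<open>Positive density of the sums of two odd primes\<close>

lemma sum_card_odd_prime_reps_ge:
  "(card {p. prime p \<and> odd p \<and> p \<le> x div 2})\<^sup>2 \<le> (\<Sum>n=1..x. card (odd_prime_reps n))"
proof -
  let ?P = "{p. prime p \<and> odd p \<and> p \<le> x div 2}"
  have "card (?P \<times> ?P) \<le> card (SIGMA n:{1..x}. odd_prime_reps n)"
  proof (rule card_inj_on_le[of "\<lambda>(p, q). (p + q, p)"])
    show "inj_on (\<lambda>(p, q). (p + q, p)) (?P \<times> ?P)" by (auto simp: inj_on_def)
    show "(\<lambda>(p, q). (p + q, p)) ` (?P \<times> ?P) \<subseteq> (SIGMA n:{1..x}. odd_prime_reps n)"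
      by (auto simp: odd_prime_reps_def Suc_le_eq prime_gt_0_nat)
  qed auto
  thus ?thesis by (simp add: card_cartesian_product power2_eq_square)
qed

text \<open>The hypothesis on \<open>ln x\<close>, true for all large \<open>x\<close>, pays for the omission of the prime \<open>2\<close>.\<close>

lemma card_odd_primes_lower_bound:
  assumes "x \<ge> 4" "ln (real x) \<le> real x * ln 2 / 24"
  shows "real x * ln 2 / 24 \<le> real (card {p. prime p \<and> odd p \<and> p \<le> x div 2}) * ln (real x)"
proof -
  let ?P = "{p. prime p \<and> odd p \<and> p \<le> x div 2}" and ?Q = "{p. prime p \<and> p \<le> x div 2}"
  have half: "x div 2 \<ge> 2" "x \<le> 3 * (x div 2)" using assms(1) by linarith+
  have finP: "finite ?P" by (rule finite_subset[of _ "{..x}"]) auto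
  have "?Q \<subseteq> insert 2 ?P" 
  proof
    fix p assume "p \<in> ?Q"
    thus "p \<in> insert 2 ?P" using prime_odd_nat[of p] prime_ge_2_nat[of p] by (cases "p = 2") auto
  qed
  hence "card ?Q \<le> card (insert 2 ?P)" using finP by (intro card_mono) auto
  also have "\<dots> \<le> card ?P + 1" using finP by (simp add: card_insert_if)
  finally have QP: "real (card ?Q) \<le> real (card ?P) + 1" by linarith
  have L: "ln (real (x div 2)) \<le> ln (real x)" "0 \<le> ln (real x)"
    using assms(1) half(1) by (auto intro: ln_mono)
  have "real x * ln 2 \<le> 3 * real (x div 2) * ln 2"
    using half(2) by (intro mult_right_mono) (linarith, simp)
  hence "real x * ln 2 / 12 \<le> real (x div 2) * ln 2 / 4" by simp
  also have "\<dots> \<le> real (card ?Q) * ln (real (x div 2))" by (rule card_primes_lower_bound) (rule half(1))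
  also have "\<dots> \<le> (real (card ?P) + 1) * ln (real x)"
    using QP L half(1) by (intro mult_mono) auto
  finally show ?thesis using assms(2) by (simp add: algebra_simps)
qed

text \<open>Apply the Cauchy-Schwarz inequality to the representation counts: the first moment is at least of
  order \<open>(x / ln x)\<^sup>2\<close>, the second moment at most of order \<open>x\<^sup>3 / (ln x)\<^sup>4\<close>.\<close>

theorem sums_of_two_odd_primes_positive_density:
  obtains c :: real and N :: nat where "c > 0"
    "\<And>x. x \<ge> N \<Longrightarrow> c * real x \<le> real (card {n\<in>{1..x}. odd_prime_reps n \<noteq> {}})"
proof -
  obtain C where C: "C > 0" "\<And>x. (\<Sum>n=1..x. abundancy (6 * n) ^ 4) \<le> C * real x"
    using sum_abundancy_pow4_le by blast
  have "eventually (\<lambda>x::nat. ln (real x) / real x < ln 2 / 24) sequentially"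
    using lim_ln_over_n by (rule order_tendstoD) simp
  then obtain N0 where N0: "\<And>x. x \<ge> N0 \<Longrightarrow> ln (real x) / real x < ln 2 / 24"
    unfolding eventually_sequentially by blast
  define c1 :: real where "c1 = ln 2 / 24"
  define c where "c = c1 ^ 4 / (2144\<^sup>2 * C)"
  have "c > 0" unfolding c_def c1_def using \<open>C > 0\<close> by simp
  moreover have "c * real x \<le> real (card {n\<in>{1..x}. odd_prime_reps n \<noteq> {}})"
    if x: "x \<ge> max 4 N0" for x
  proof -
    let ?R = "\<lambda>n. real (card (odd_prime_reps n))" and ?L = "ln (real x)"
    let ?E = "{n\<in>{1..x}. odd_prime_reps n \<noteq> {}}"
    let ?K = "real (card {p. prime p \<and> odd p \<and> p \<le> x div 2})"
    have "?L > 0" "real x > 0" using x by auto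
    have KL: "c1 * real x \<le> ?K * ?L"
      using card_odd_primes_lower_bound[of x] N0[of x] x by (simp add: c1_def field_simps)
    have "?K\<^sup>2 \<le> (\<Sum>n=1..x. ?R n)"
      using of_nat_mono[OF sum_card_odd_prime_reps_ge[of x], where ?'a = real]
      by (simp only: of_nat_power of_nat_sum)
    also have "\<dots> = (\<Sum>n\<in>?E. ?R n * 1)" by (simp, intro sum.mono_neutral_right) auto
    finally have "(?K\<^sup>2)\<^sup>2 \<le> (\<Sum>n\<in>?E. ?R n * 1)\<^sup>2" by (intro power_mono) auto
    also have "\<dots> \<le> (\<Sum>n\<in>?E. (?R n)\<^sup>2) * (\<Sum>n\<in>?E. 1\<^sup>2)" by (rule Cauchy_Schwarz_ineq_sum)
    also have "\<dots> = (\<Sum>n\<in>?E. (?R n)\<^sup>2) * real (card ?E)" by simp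
    also have "\<dots> \<le> (2144\<^sup>2 * C * real x ^ 3 / ?L ^ 4) * real (card ?E)"
    proof (rule mult_right_mono)
      have "(\<Sum>n\<in>?E. (?R n)\<^sup>2) \<le> (\<Sum>n=1..x. (?R n)\<^sup>2)" by (intro sum_mono2) auto
      also have "\<dots> \<le> (\<Sum>n=1..x. (2144 * real x / ?L\<^sup>2)\<^sup>2 * abundancy (6 * n) ^ 4)"
      proof (rule sum_mono)
        fix n assume "n \<in> {1..x}"
        hence "?R n \<le> 2144 * (abundancy (6 * n))\<^sup>2 * real x / ?L\<^sup>2"
          using x by (intro card_odd_prime_reps_le) auto
        hence "(?R n)\<^sup>2 \<le> (2144 * (abundancy (6 * n))\<^sup>2 * real x / ?L\<^sup>2)\<^sup>2"
          by (intro power_mono) auto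
        thus "(?R n)\<^sup>2 \<le> (2144 * real x / ?L\<^sup>2)\<^sup>2 * abundancy (6 * n) ^ 4"
          by (simp add: power_mult_distrib power_divide mult_ac)
      qed
      also have "\<dots> = (2144 * real x / ?L\<^sup>2)\<^sup>2 * (\<Sum>n=1..x. abundancy (6 * n) ^ 4)"
        by (simp add: sum_distrib_left)
      also have "\<dots> \<le> (2144 * real x / ?L\<^sup>2)\<^sup>2 * (C * real x)"
        by (intro mult_left_mono C(2)) auto
      also have "\<dots> = 2144\<^sup>2 * C * real x ^ 3 / ?L ^ 4"
        by (simp add: power_mult_distrib power_divide power4_eq_xxxx power3_eq_cube
            power2_eq_square mult_ac)
      finally show "(\<Sum>n\<in>?E. (?R n)\<^sup>2) \<le> 2144\<^sup>2 * C * real x ^ 3 / ?L ^ 4" .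
    qed auto
    finally have "?K ^ 4 * ?L ^ 4 \<le> 2144\<^sup>2 * C * real x ^ 3 * real (card ?E)"
      using \<open>?L > 0\<close> by (simp add: pos_le_divide_eq)
    moreover have "(c1 * real x) ^ 4 \<le> (?K * ?L) ^ 4"
      using KL by (intro power_mono) (auto simp: c1_def)
    ultimately have "c1 ^ 4 * real x * real x ^ 3 \<le> 2144\<^sup>2 * C * real (card ?E) * real x ^ 3"
      by (simp add: power_mult_distrib power_numeral_reduce mult_ac)
    hence "c1 ^ 4 * real x \<le> 2144\<^sup>2 * C * real (card ?E)"
      using \<open>real x > 0\<close> by simp
    thus ?thesis using \<open>C > 0\<close> by (simp add: c_def field_simps)
  qed
  ultimately show ?thesis by (rule that)
qed

section \<open>Every integer from 8 on is a sum of boundedly many odd primes\<close>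

text \<open>A sum of \<open>h\<close> elements of \<open>{0, 1}\<close> or sums of two odd primes is a sum of at most \<open>2 h\<close> odd primes and
  at most \<open>h\<close> ones.\<close>

lemma ex_odd_prime_list_plus_remainder:
  assumes "set xs \<subseteq> {0, 1} \<union> {n. odd_prime_reps n \<noteq> {}}"
  shows "\<exists>ps l. (\<forall>p\<in>set ps. prime p \<and> odd p) \<and> length ps \<le> 2 * length xs \<and> l \<le> length xs
     \<and> sum_list xs = sum_list ps + l"
  using assms
proof (induction xs)
  case Nil
  show ?case by (intro exI[of _ "[]"] exI[of _ 0]) simp
next
  case (Cons x xs)
  then obtain ps l where IH: "\<forall>p\<in>set ps. prime p \<and> odd p" "length ps \<le> 2 * length xs"
    "l \<le> length xs" "sum_list xs = sum_list ps + l" by auto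
  show ?case
  proof (cases "x \<in> {0, 1}")
    case True
    thus ?thesis using IH by (intro exI[of _ ps] exI[of _ "l + x"]) auto
  next
    case False
    then obtain p where "p \<in> odd_prime_reps x" using Cons.prems by auto
    hence "prime p" "odd p" "prime (x - p)" "odd (x - p)" "x = p + (x - p)"
      by (auto simp: odd_prime_reps_def)
    thus ?thesis using IH by (intro exI[of _ "p # (x - p) # ps"] exI[of _ l]) auto
  qed
qed

lemma ex_eq_3_5_combination:
  fixes m :: nat
  assumes "m \<ge> 8"
  shows "\<exists>a b. m = 3 * a + 5 * b"
  using assms by presburger

text \<open>The Goldbach-Schnirelmann theorem for odd primes. The ones in the representation of \<open>n - 8\<close>, at
  most \<open>h\<close> of them, are combined with the \<open>8\<close> that was set aside and rewritten in terms of \<open>3\<close> and \<open>5\<close>.\<close>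

theorem sum_of_bounded_number_of_odd_primes:
  obtains K where "\<And>n::nat. n \<ge> 8 \<Longrightarrow>
    \<exists>ps. (\<forall>p\<in>set ps. prime p \<and> odd p) \<and> length ps \<le> K \<and> sum_list ps = n"
proof -
  let ?A = "{0, 1} \<union> {n. odd_prime_reps n \<noteq> {}}"
  obtain c N where c: "c > 0"
    "\<And>x. x \<ge> N \<Longrightarrow> c * real x \<le> real (card {n\<in>{1..x}. odd_prime_reps n \<noteq> {}})"
    using sums_of_two_odd_primes_positive_density by blast
  \<comment> \<open>Below \<open>N\<close> the element \<open>1\<close> of the set alone guarantees the density.\<close>
  define \<alpha> where "\<alpha> = min c (1 / (real N + 1))"
  have "\<alpha> * real n \<le> real (card (?A \<inter> {1..n}))" for n
  proof (cases "n \<ge> N")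
    case True
    have "\<alpha> * real n \<le> c * real n" by (intro mult_right_mono) (auto simp: \<alpha>_def)
    also have "\<dots> \<le> real (card {m\<in>{1..n}. odd_prime_reps m \<noteq> {}})" using True by (rule c(2))
    also have "\<dots> \<le> real (card (?A \<inter> {1..n}))" by (intro of_nat_mono card_mono) auto
    finally show ?thesis .
  next
    case False
    show ?thesis
    proof (cases "n = 0")
      case False
      have "\<alpha> * real n \<le> 1 / (real N + 1) * real n" by (intro mult_right_mono) (auto simp: \<alpha>_def)
      also have "\<dots> \<le> real (card {1::nat})" using \<open>\<not> n \<ge> N\<close> by (simp add: field_simps)
      also have "\<dots> \<le> real (card (?A \<inter> {1..n}))"
        using False by (intro of_nat_mono card_mono) auto
      finally show ?thesis .
    qed simp
  qed
  moreover have "\<alpha> > 0" unfolding \<alpha>_def using c(1) by simp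
  ultimately obtain h where h: "\<And>n. n \<in> sumset_power ?A h"
    using schnirelmann_basis[of ?A \<alpha>] by blast
  have "\<exists>ps. (\<forall>p\<in>set ps. prime p \<and> odd p) \<and> length ps \<le> 3 * h + 8 \<and> sum_list ps = n"
    if "n \<ge> 8" for n :: nat
  proof -
    obtain xs where xs: "length xs = h" "set xs \<subseteq> ?A" "n - 8 = sum_list xs"
      using h[of "n - 8"] unfolding sumset_power_def by blast
    obtain ps l where ps: "\<forall>p\<in>set ps. prime p \<and> odd p" "length ps \<le> 2 * h" "l \<le> h"
      "n - 8 = sum_list ps + l"
      using ex_odd_prime_list_plus_remainder[OF xs(2)] xs by auto
    obtain a b where ab: "l + 8 = 3 * a + 5 * b" using ex_eq_3_5_combination[of "l + 8"] by auto
    let ?qs = "ps @ replicate a 3 @ replicate b 5"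
    have "prime (3::nat)" "prime (5::nat)" by simp_all
    hence "\<forall>p\<in>set ?qs. prime p \<and> odd p" using ps(1) by auto
    moreover have "length ?qs \<le> 3 * h + 8" using ps ab by simp
    moreover have "sum_list ?qs = n" using ps(4) ab that by (simp add: sum_list_replicate)
    ultimately show ?thesis by blast
  qed
  thus ?thesis by (rule that)
qed

section \<open>The linear system\<close>

text \<open>The greedy splitting that turns \<open>a + b = p\<^sub>1 + \<dots> + p\<^sub>k\<close> into two rows with sums \<open>a\<close> and \<open>b\<close>.\<close>

lemma ex_split_sum_list:
  fixes ps :: "nat list"
  assumes "a \<le> sum_list ps"
  shows "\<exists>ys. length ys = length ps \<and> (\<forall>i<length ps. ys ! i \<le> ps ! i) \<and> sum_list ys = a"
  using assms
proof (induction ps arbitrary: a)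
  case Nil
  thus ?case by simp
next
  case (Cons p ps)
  have "a - min a p \<le> sum_list ps" using Cons.prems by auto
  then obtain ys where "length ys = length ps" "\<forall>i<length ps. ys ! i \<le> ps ! i"
    "sum_list ys = a - min a p" using Cons.IH by blast
  thus ?case by (intro exI[of _ "min a p # ys"]) (auto simp: nth_Cons split: nat.splits)
qed

theorem theorem2:
  shows "\<exists>k\<^sub>0::nat. \<forall>a b :: int. a > 6 \<and> a \<ge> b \<and> b > 0 \<longrightarrow>
    (\<exists>k::nat. 0 < k \<and> k \<le> k\<^sub>0 \<and>
      (\<exists>(x :: nat \<Rightarrow> nat \<Rightarrow> int) (p :: nat \<Rightarrow> int).
        (\<forall>i\<in>{1, 2}. \<forall>j\<in>{1..k}. x i j \<ge> 0) \<and>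
        (\<Sum>i=1..k. x 1 i) = a \<and>
        (\<Sum>j=1..k. x 2 j) = b \<and>
        (\<forall>s\<in>{1..k}. x 1 s + x 2 s = p s \<and> prime (p s) \<and> odd (p s))))"
proof -
  obtain K where K: "\<And>n::nat. n \<ge> 8 \<Longrightarrow>
    \<exists>ps. (\<forall>p\<in>set ps. prime p \<and> odd p) \<and> length ps \<le> K \<and> sum_list ps = n"
    using sum_of_bounded_number_of_odd_primes by blast
  show ?thesis
  proof (rule exI[of _ K], intro allI impI)
    fix a b :: int assume ab: "a > 6 \<and> a \<ge> b \<and> b > 0"
    define n where "n = nat (a + b)"
    have "n \<ge> 8" using ab unfolding n_def by linarith
    then obtain ps where ps: "\<forall>p\<in>set ps. prime p \<and> odd p" "length ps \<le> K" "sum_list ps = n"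
      using K by blast
    have "nat a \<le> sum_list ps" using ab ps(3) unfolding n_def by linarith
    then obtain ys where ys: "length ys = length ps" "\<forall>i<length ps. ys ! i \<le> ps ! i"
      "sum_list ys = nat a" using ex_split_sum_list by blast
    define x :: "nat \<Rightarrow> nat \<Rightarrow> int" where
      "x i s = (if i = 1 then int (ys ! (s - 1)) else int (ps ! (s - 1)) - int (ys ! (s - 1)))" for i s
    define p where "p s = int (ps ! (s - 1))" for s
    let ?k = "length ps"
    have sum1: "(\<Sum>i=1..?k. int (zs ! (i - 1))) = int (sum_list zs)" if "length zs = ?k" for zs
      using that by (simp add: sum.atLeast1_atMost_eq sum_list_sum_nth atLeast0LessThan)
    have "0 < ?k" using ps(3) \<open>n \<ge> 8\<close> by (cases ps) auto
    moreover have "\<forall>i\<in>{1, 2}. \<forall>j\<in>{1..?k}. x i j \<ge> 0" using ys(2) by (auto simp: x_def)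
    moreover have "(\<Sum>i=1..?k. x 1 i) = a"
      using sum1[OF ys(1)] ys(3) ab by (simp add: x_def)
    moreover have "(\<Sum>j=1..?k. x 2 j) = b"
      using sum1[OF ys(1)] sum1[OF refl] ys(3) ps(3) ab by (simp add: x_def sum_subtractf n_def)
    moreover have "\<forall>s\<in>{1..?k}. x 1 s + x 2 s = p s \<and> prime (p s) \<and> odd (p s)"
      using ps(1) by (auto simp: x_def p_def)
    ultimately show "\<exists>k::nat. 0 < k \<and> k \<le> K \<and>
      (\<exists>(x :: nat \<Rightarrow> nat \<Rightarrow> int) (p :: nat \<Rightarrow> int).
        (\<forall>i\<in>{1, 2}. \<forall>j\<in>{1..k}. x i j \<ge> 0) \<and>
        (\<Sum>i=1..k. x 1 i) = a \<and>
        (\<Sum>j=1..k. x 2 j) = b \<and>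
        (\<forall>s\<in>{1..k}. x 1 s + x 2 s = p s \<and> prime (p s) \<and> odd (p s)))"
      using ps(2) by (intro exI[of _ ?k] exI[of _ x] exI[of _ p] conjI)
  qed
qed

end
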